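(* Let $B$ be a separable Banach space, let $\chi$ be a Chi-subspace of $(B\hat\otimes_\pi B)^*$ and let $\mathbb X$ be a $B$-valued continuous process admitting a $\chi$-quadratic variation $\widetilde{[\mathbb X]}$. Let $F:[0,T]\times B\to\mathbb R$ be Fréchet of class $C^{1,2}$ such that $D^2F(t,\eta)\in\chi$ for all $t\in[0,T]$ and $\eta\in B$, and such that $D^2F:[0,T]\times B\to\chi$ is continuous. Then for every $t\in[0,T]$ the forward integral $\int_0^t {}_{B^*}\langle DF(s,\mathbb X_s),d^-\mathbb X_s\rangle_B$ exists and $$F(t,\mathbb X_t)=F(0,\mathbb X_0)+\int_0^t\partial_tF(s,\mathbb X_s)\,ds+\int_0^t{}_{B^*}\langle DF(s,\mathbb X_s),d^-\mathbb X_s\rangle_B+\frac12\int_0^t{}_{\chi}\langle D^2F(s,\mathbb X_s),d\widetilde{[\mathbb X]}_s\rangle_{\chi^*}.$$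
   Context: Fix $T>0$ and a probability space $(\Omega,\mathcal F,\mathbb P)$ with a filtration $(\mathcal F_t)$ satisfying the usual conditions. Every process $\mathbb X=(\mathbb X_t)_{t\in[0,T]}$ is extended by $\mathbb X_t=\mathbb X_0$ for $t\le0$ and $\mathbb X_t=\mathbb X_T$ for $t\ge T$. $\mathscr C([0,T])$ is the space of real continuous processes on $[0,T]$ with the topology of uniform convergence in probability (ucp). $B\hat\otimes_\pi B$ is the projective tensor product; its dual is identified with the bounded bilinear forms on $B\times B$. A Chi-subspace $\chi$ of $(B\hat\otimes_\pi B)^*$ is a Banach space $\chi\subset(B\hat\otimes_\pi B)^*$ with continuous inclusion. Elements of $B\hat\otimes_\pi B$ are regarded (through the canonical map into the bidual and restriction) as elements of $\chi^*$; $x\otimes^2:=x\otimes x$. $\mathbb X$ admits a $\chi$-quadratic variation if the following hold. (H1) Every sequence $\epsilon_n\downarrow0$ has a subsequence $(\epsilon_{n_k})$ with $\sup_k\int_0^T\epsilon_{n_k}^{-1}\|(\mathbb X_{s+\epsilon_{n_k}}-\mathbb X_s)\otimes^2\|_{\chi^*}\,ds<\infty$ a.s. (H2)(i) There is a map $[\mathbb X]:\chi\to\mathscr C([0,T])$ such that for every $\phi\in\chi$ the processes $[\mathbb X]^\epsilon(\phi)_t:=\int_0^t{}_\chi\langle\phi,\epsilon^{-1}(\mathbb X_{s+\epsilon}-\mathbb X_s)\otimes^2\rangle_{\chi^*}ds$ converge ucp to $[\mathbb X](\phi)$ as $\epsilon\to0+$. (H2)(ii) There is a measurable process $\widetilde{[\mathbb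 X]}:\Omega\times[0,T]\to\chi^*$ which has for almost all $\omega$ (càdlàg) bounded variation paths and satisfies $\widetilde{[\mathbb X]}(\cdot,t)(\phi)=[\mathbb X](\phi)(\cdot,t)$ a.s. for all $\phi\in\chi$, $t\in[0,T]$. The process $\widetilde{[\mathbb X]}$ is the $\chi$-quadratic variation. Integrals against $d\widetilde{[\mathbb X]}$ are pathwise Lebesgue–Stieltjes type integrals. $F:[0,T]\times B\to\mathbb R$ is Fréchet of class $C^{1,2}$ if $F$ is once continuously Fréchet differentiable (with time derivative $\partial_tF$), $\eta\mapsto DF(t,\eta)\in B^*$ is of class $C^1$ for every $t$ ($DF$ denoting the Fréchet derivative in the second variable), and the second Fréchet derivative in the second variable $D^2F:[0,T]\times B\to(B\hat\otimes_\pi B)^*$ is continuous. For a continuous $B$-valued process $\mathbb X$ and a strongly measurable $B^*$-valued process $\mathbb Y$ with $\int_0^T\|\mathbb Y_s\|_{B^*}ds<\infty$ a.s., the forward integral $\int_0^t{}_{B^*}\langle\mathbb Y_s,d^-\mathbb X_s\rangle_B$ is (if it exists) the limit in probability as $\epsilon\to0$ of $\int_0^t{}_{B^*}\langle\mathbb Y_s,\frac{\mathbb X_{s+\epsilon}-\mathbb X_s}{\epsilon}\rangle_B\,ds$. *)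

theory Defs
  imports "HOL-Probability.Probability"
begin

section \<open>Processes on \<open>[0,T]\<close>\<close>

text \<open>A process on \<open>[0,T]\<close> is a function of time and scenario; only its values at times in
  \<open>{0..T}\<close> matter. The usual extension by constants to the whole real line is the following.\<close>

definition extend_process :: "real \<Rightarrow> (real \<Rightarrow> 'w \<Rightarrow> 'x) \<Rightarrow> real \<Rightarrow> 'w \<Rightarrow> 'x" where
  "extend_process T X t = X (max 0 (min T t))"

definition usual_conditions :: "'w measure \<Rightarrow> real \<Rightarrow> (real \<Rightarrow> 'w measure) \<Rightarrow> bool" where
  "usual_conditions M T \<F> \<longleftrightarrow>
     filtration (space M) (\<lambda>t. \<F> (max 0 (min T t))) \<and>
     (\<forall>t\<in>{0..T}. subalgebra M (\<F> t)) \<and>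
     (\<forall>t\<in>{0..<T}. sets (\<F> t) = (\<Inter>u\<in>{t<..T}. sets (\<F> u))) \<and>
     (\<forall>N\<in>null_sets M. \<forall>A. A \<subseteq> N \<longrightarrow> A \<in> sets (\<F> 0))"

definition continuous_process ::
  "'w measure \<Rightarrow> real \<Rightarrow> (real \<Rightarrow> 'w \<Rightarrow> 'x::topological_space) \<Rightarrow> bool" where
  "continuous_process M T X \<longleftrightarrow>
     (\<forall>t\<in>{0..T}. X t \<in> borel_measurable M) \<and>
     (AE \<omega> in M. continuous_on {0..T} (\<lambda>t. X t \<omega>))"

definition measurable_process ::
  "'w measure \<Rightarrow> real \<Rightarrow> (real \<Rightarrow> 'w \<Rightarrow> 'x::topological_space) \<Rightarrow> bool" where
  "measurable_process M T X \<longleftrightarrow>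
     (\<lambda>(\<omega>, t). X t \<omega>) \<in> borel_measurable (M \<Otimes>\<^sub>M restrict_space borel {0..T})"

text \<open>Strong (Bochner) measurability; for a nonseparable target space this is stronger than
  Borel measurability.\<close>

definition strongly_measurable_process ::
  "'w measure \<Rightarrow> real \<Rightarrow> (real \<Rightarrow> 'w \<Rightarrow> 'x::topological_space) \<Rightarrow> bool" where
  "strongly_measurable_process M T Y \<longleftrightarrow>
     (\<exists>S. (\<forall>n::nat. simple_function (M \<Otimes>\<^sub>M restrict_space lborel {0..T}) (S n)) \<and>
          (AE z in M \<Otimes>\<^sub>M restrict_space lborel {0..T}.
             (\<lambda>n. S n z) \<longlonglongrightarrow> Y (snd z) (fst z)))"

definition converges_in_probability ::
  "'w measure \<Rightarrow> ('i \<Rightarrow> 'w \<Rightarrow> real) \<Rightarrow> ('w \<Rightarrow> real) \<Rightarrow> 'i filter \<Rightarrow> bool" where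
  "converges_in_probability M Z L \<G> \<longleftrightarrow>
     L \<in> borel_measurable M \<and> (\<forall>\<^sub>F i in \<G>. Z i \<in> borel_measurable M) \<and>
     (\<forall>\<delta>>0. ((\<lambda>i. measure M {\<omega>\<in>space M. \<delta> < \<bar>Z i \<omega> - L \<omega>\<bar>}) \<longlongrightarrow> 0) \<G>)"

definition converges_ucp ::
  "'w measure \<Rightarrow> real \<Rightarrow> ('i \<Rightarrow> real \<Rightarrow> 'w \<Rightarrow> real) \<Rightarrow> (real \<Rightarrow> 'w \<Rightarrow> real) \<Rightarrow> 'i filter \<Rightarrow> bool"
  where
  "converges_ucp M T Z L \<G> \<longleftrightarrow>
     continuous_process M T L \<and> (\<forall>\<^sub>F i in \<G>. continuous_process M T (Z i)) \<and>
     (\<forall>\<delta>>0. ((\<lambda>i. measure M {\<omega>\<in>space M.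
         ennreal \<delta> < (SUP t\<in>{0..T}. ennreal \<bar>Z i t \<omega> - L t \<omega>\<bar>)}) \<longlongrightarrow> 0) \<G>)"


section \<open>Paths of bounded variation and Lebesgue--Stieltjes integrals\<close>

definition total_variation :: "real \<Rightarrow> real \<Rightarrow> (real \<Rightarrow> 'x::real_normed_vector) \<Rightarrow> ennreal" where
  "total_variation a b v =
     (SUP (n, p)\<in>{(n::nat, p::nat \<Rightarrow> real). mono p \<and> range p \<subseteq> {a..b}}.
        (\<Sum>i<n. ennreal (norm (v (p (Suc i)) - v (p i)))))"

definition cadlag_on :: "real \<Rightarrow> real \<Rightarrow> (real \<Rightarrow> 'x::topological_space) \<Rightarrow> bool" where
  "cadlag_on a b v \<longleftrightarrow>
     (\<forall>t\<in>{a..<b}. (v \<longlongrightarrow> v t) (at_right t)) \<and>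
     (\<forall>t\<in>{a<..b}. \<exists>l. (v \<longlongrightarrow> l) (at_left t))"

text \<open>The total variation measure \<open>|dv|\<close> on \<open>{a<..b}\<close>, extended by zero to a Borel measure on the
  line, for a cadlag \<open>v\<close> of bounded variation on \<open>{a..b}\<close>.\<close>

definition variation_measure :: "real \<Rightarrow> real \<Rightarrow> (real \<Rightarrow> 'x::real_normed_vector) \<Rightarrow> real measure"
  where
  "variation_measure a b v =
     interval_measure (\<lambda>x. enn2real (total_variation a (max a (min b x)) v))"

text \<open>Step functions are finite sums of \<open>1\<^bsub>(c,d]\<^esub> \<phi>\<close>, given by the triples \<open>(c, d, \<phi>)\<close>.\<close>

definition step_fun :: "(real \<times> real \<times> 'c::real_normed_vector) list \<Rightarrow> real \<Rightarrow> 'c" where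
  "step_fun ps x = (\<Sum>(c, d, \<phi>)\<leftarrow>ps. indicat_real {c<..d} x *\<^sub>R \<phi>)"

definition step_integral ::
  "(real \<Rightarrow> 'c::real_normed_vector \<Rightarrow>\<^sub>L real) \<Rightarrow> (real \<times> real \<times> 'c) list \<Rightarrow> real" where
  "step_integral v ps = (\<Sum>(c, d, \<phi>)\<leftarrow>ps. (v d - v c) \<phi>)"

text \<open>\<open>I = \<integral>\<^bsub>(a,b]\<^esub> \<langle>g(s), dv(s)\<rangle>\<close>: the elementary integral of step functions, extended by
  continuity to the integrands that are Bochner integrable with respect to \<open>|dv|\<close>. A mass at the
  left endpoint \<open>a\<close> is not counted.\<close>

definition has_stieltjes_integral ::
  "real \<Rightarrow> real \<Rightarrow> (real \<Rightarrow> 'c::real_normed_vector) \<Rightarrow> (real \<Rightarrow> 'c \<Rightarrow>\<^sub>L real) \<Rightarrow> real \<Rightarrow> bool" where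
  "has_stieltjes_integral a b g v I \<longleftrightarrow>
     (\<exists>ps. (\<forall>n::nat. \<forall>(c, d, \<phi>)\<in>set (ps n). a \<le> c \<and> c \<le> d \<and> d \<le> b) \<and>
        (AE x in variation_measure a b v.
           x \<in> {a<..b} \<longrightarrow> (\<lambda>n. step_fun (ps n) x) \<longlonglongrightarrow> g x) \<and>
        (\<lambda>n. \<integral>\<^sup>+x\<in>{a<..b}. ennreal (norm (step_fun (ps n) x - g x)) \<partial>variation_measure a b v)
           \<longlonglongrightarrow> 0 \<and>
        (\<lambda>n. step_integral v (ps n)) \<longlonglongrightarrow> I)"


section \<open>Chi-subspaces and the quadratic variation\<close>

text \<open>The dual of the projective tensor square of \<open>'b\<close> is the space \<open>'b \<Rightarrow>\<^sub>L 'b \<Rightarrow>\<^sub>L real\<close> of bounded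
  bilinear forms. A Chi-subspace is a Banach space \<open>'c\<close> (with its own norm) together with its
  continuous inclusion \<open>\<iota>\<close>.\<close>

definition chi_subspace ::
  "('c::banach \<Rightarrow>\<^sub>L 'b::banach \<Rightarrow>\<^sub>L 'b \<Rightarrow>\<^sub>L real) \<Rightarrow> bool" where
  "chi_subspace \<iota> \<longleftrightarrow> inj (blinfun_apply \<iota>)"

text \<open>The elementary tensor \<open>x \<otimes> y\<close> as an element of the bidual, and its restriction to the
  Chi-subspace.\<close>

definition tensor ::
  "'b::real_normed_vector \<Rightarrow> 'b \<Rightarrow> ('b \<Rightarrow>\<^sub>L 'b \<Rightarrow>\<^sub>L real) \<Rightarrow>\<^sub>L real" where
  "tensor x y = Blinfun (\<lambda>\<beta>. blinfun_apply (blinfun_apply \<beta> x) y)"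

lemma tensor_apply [simp]:
  "blinfun_apply (tensor x y) \<beta> = blinfun_apply (blinfun_apply \<beta> x) y"
  unfolding tensor_def by (subst bounded_linear_Blinfun_apply) (intro bounded_linear_intros, simp)

definition chi_tensor ::
  "('c::real_normed_vector \<Rightarrow>\<^sub>L 'b::real_normed_vector \<Rightarrow>\<^sub>L 'b \<Rightarrow>\<^sub>L real) \<Rightarrow> 'b \<Rightarrow> 'b \<Rightarrow> 'c \<Rightarrow>\<^sub>L real"
  where
  "chi_tensor \<iota> x y = tensor x y o\<^sub>L \<iota>"

definition increment_square ::
  "real \<Rightarrow> ('c::real_normed_vector \<Rightarrow>\<^sub>L 'b::real_normed_vector \<Rightarrow>\<^sub>L 'b \<Rightarrow>\<^sub>L real) \<Rightarrow>
   (real \<Rightarrow> 'w \<Rightarrow> 'b) \<Rightarrow> real \<Rightarrow> real \<Rightarrow> 'w \<Rightarrow> 'c \<Rightarrow>\<^sub>L real" where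
  "increment_square T \<iota> X \<epsilon> s \<omega> =
     (let \<Delta> = extend_process T X (s + \<epsilon>) \<omega> - extend_process T X s \<omega> in chi_tensor \<iota> \<Delta> \<Delta>)"

definition qv_H1 ::
  "'w measure \<Rightarrow> real \<Rightarrow> ('c::real_normed_vector \<Rightarrow>\<^sub>L 'b::real_normed_vector \<Rightarrow>\<^sub>L 'b \<Rightarrow>\<^sub>L real) \<Rightarrow>
   (real \<Rightarrow> 'w \<Rightarrow> 'b) \<Rightarrow> bool" where
  "qv_H1 M T \<iota> X \<longleftrightarrow>
     (\<forall>\<epsilon>::nat \<Rightarrow> real. (\<forall>n. 0 < \<epsilon> n) \<and> decseq \<epsilon> \<and> \<epsilon> \<longlonglongrightarrow> 0 \<longrightarrow>
        (\<exists>r::nat \<Rightarrow> nat. strict_mono r \<and>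
           (AE \<omega> in M. (SUP k. \<integral>\<^sup>+s\<in>{0..T}.
              ennreal (inverse (\<epsilon> (r k)) * norm (increment_square T \<iota> X (\<epsilon> (r k)) s \<omega>)) \<partial>lborel)
              < \<infinity>)))"

definition qv_approx ::
  "real \<Rightarrow> ('c::real_normed_vector \<Rightarrow>\<^sub>L 'b::real_normed_vector \<Rightarrow>\<^sub>L 'b \<Rightarrow>\<^sub>L real) \<Rightarrow>
   (real \<Rightarrow> 'w \<Rightarrow> 'b) \<Rightarrow> 'c \<Rightarrow> real \<Rightarrow> real \<Rightarrow> 'w \<Rightarrow> real" where
  "qv_approx T \<iota> X \<phi> \<epsilon> t \<omega> =
     (LBINT s:{0..t}. (inverse \<epsilon> *\<^sub>R increment_square T \<iota> X \<epsilon> s \<omega>) \<phi>)"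

definition qv_H2i ::
  "'w measure \<Rightarrow> real \<Rightarrow> ('c::real_normed_vector \<Rightarrow>\<^sub>L 'b::real_normed_vector \<Rightarrow>\<^sub>L 'b \<Rightarrow>\<^sub>L real) \<Rightarrow>
   (real \<Rightarrow> 'w \<Rightarrow> 'b) \<Rightarrow> ('c \<Rightarrow> real \<Rightarrow> 'w \<Rightarrow> real) \<Rightarrow> bool" where
  "qv_H2i M T \<iota> X Q \<longleftrightarrow> (\<forall>\<phi>. converges_ucp M T (qv_approx T \<iota> X \<phi>) (Q \<phi>) (at_right 0))"

definition qv_H2ii ::
  "'w measure \<Rightarrow> real \<Rightarrow> ('c::real_normed_vector \<Rightarrow> real \<Rightarrow> 'w \<Rightarrow> real) \<Rightarrow>
   (real \<Rightarrow> 'w \<Rightarrow> 'c \<Rightarrow>\<^sub>L real) \<Rightarrow> bool" where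
  "qv_H2ii M T Q V \<longleftrightarrow>
     measurable_process M T V \<and>
     (AE \<omega> in M. cadlag_on 0 T (\<lambda>t. V t \<omega>) \<and> total_variation 0 T (\<lambda>t. V t \<omega>) < \<infinity>) \<and>
     (\<forall>\<phi>. \<forall>t\<in>{0..T}. AE \<omega> in M. V t \<omega> \<phi> = Q \<phi> t \<omega>)"

text \<open>\<open>X\<close> admits a chi-quadratic variation, and \<open>V\<close> (with values in the dual of \<open>'c\<close>) is one.\<close>

definition chi_quadratic_variation ::
  "'w measure \<Rightarrow> real \<Rightarrow> ('c::real_normed_vector \<Rightarrow>\<^sub>L 'b::real_normed_vector \<Rightarrow>\<^sub>L 'b \<Rightarrow>\<^sub>L real) \<Rightarrow>
   (real \<Rightarrow> 'w \<Rightarrow> 'b) \<Rightarrow> (real \<Rightarrow> 'w \<Rightarrow> 'c \<Rightarrow>\<^sub>L real) \<Rightarrow> bool" where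
  "chi_quadratic_variation M T \<iota> X V \<longleftrightarrow>
     qv_H1 M T \<iota> X \<and> (\<exists>Q. qv_H2i M T \<iota> X Q \<and> qv_H2ii M T Q V)"


section \<open>Functions of class \<open>C\<^sup>1\<^sup>,\<^sup>2\<close> and the forward integral\<close>

text \<open>At the endpoints of \<open>{0..T}\<close> the time derivative is one-sided.\<close>

definition frechet_C12 ::
  "real \<Rightarrow> (real \<Rightarrow> 'b::real_normed_vector \<Rightarrow> real) \<Rightarrow> (real \<Rightarrow> 'b \<Rightarrow> real) \<Rightarrow>
   (real \<Rightarrow> 'b \<Rightarrow> 'b \<Rightarrow>\<^sub>L real) \<Rightarrow> (real \<Rightarrow> 'b \<Rightarrow> 'b \<Rightarrow>\<^sub>L 'b \<Rightarrow>\<^sub>L real) \<Rightarrow> bool" where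
  "frechet_C12 T F F\<^sub>t DF D2F \<longleftrightarrow>
     (\<forall>t\<in>{0..T}. \<forall>\<eta>. ((\<lambda>(s, \<xi>). F s \<xi>) has_derivative (\<lambda>(h, k). h * F\<^sub>t t \<eta> + DF t \<eta> k))
        (at (t, \<eta>) within {0..T} \<times> UNIV)) \<and>
     continuous_on ({0..T} \<times> UNIV) (\<lambda>(t, \<eta>). F\<^sub>t t \<eta>) \<and>
     continuous_on ({0..T} \<times> UNIV) (\<lambda>(t, \<eta>). DF t \<eta>) \<and>
     (\<forall>t\<in>{0..T}. (\<forall>\<eta>. (DF t has_derivative blinfun_apply (D2F t \<eta>)) (at \<eta>)) \<and>
        continuous_on UNIV (D2F t)) \<and>
     continuous_on ({0..T} \<times> UNIV) (\<lambda>(t, \<eta>). D2F t \<eta>)"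

text \<open>The random variable \<open>I\<close> is the forward integral of \<open>Y\<close> against \<open>X\<close> over \<open>{0..t}\<close>; the first
  three conditions say that \<open>X\<close> and \<open>Y\<close> belong to the class of processes for which the
  integral is considered.\<close>

definition has_forward_integral ::
  "'w measure \<Rightarrow> real \<Rightarrow> (real \<Rightarrow> 'w \<Rightarrow> 'b::real_normed_vector \<Rightarrow>\<^sub>L real) \<Rightarrow> (real \<Rightarrow> 'w \<Rightarrow> 'b) \<Rightarrow>
   real \<Rightarrow> ('w \<Rightarrow> real) \<Rightarrow> bool" where
  "has_forward_integral M T Y X t I \<longleftrightarrow>
     continuous_process M T X \<and>
     strongly_measurable_process M T Y \<and>
     (AE \<omega> in M. (\<integral>\<^sup>+s\<in>{0..T}. ennreal (norm (Y s \<omega>)) \<partial>lborel) < \<infinity>) \<and>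
     converges_in_probability M
       (\<lambda>\<epsilon> \<omega>. LBINT s:{0..t}.
          Y s \<omega> (inverse \<epsilon> *\<^sub>R (extend_process T X (s + \<epsilon>) \<omega> - extend_process T X s \<omega>)))
       I (at_right 0)"

end

theory Submission
  imports Defs
begin

text \<open>Write \<open>\<Delta>\<close> for the increment of \<open>X\<close> over \<open>[s, s + \<epsilon>]\<close>. Since \<open>s \<mapsto> F(s, X\<^sub>s)\<close> is continuous, the
  integral over \<open>[0, t]\<close> of its difference quotient of step \<open>\<epsilon>\<close> tends to \<open>F(t, X\<^sub>t) - F(0, X\<^sub>0)\<close>.
  Each of these increments splits into a time increment and a space increment, and a second-order
  Taylor expansion of the latter yields
    \<open>\<langle>DF(s, X\<^sub>s), \<Delta>\<rangle> + 1/2 \<langle>D\<^sup>2F(s, X\<^sub>s), \<Delta> \<otimes> \<Delta>\<rangle>\<close> and a remainder.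
  The time increments contribute \<open>\<integral> \<partial>\<^sub>tF ds\<close>. The remainder is at most the modulus of continuity
  of \<open>D\<^sup>2F\<close>, taken in the norm of the Chi-subspace, times the norm of \<open>\<Delta> \<otimes> \<Delta>\<close> in its dual;
  the latter, divided by \<open>\<epsilon>\<close> and integrated, is bounded along a subsequence by (H1).
  So the forward integral converges as soon as the second-order term does
  (\<open>pathwise_ito\<close>).

  For the second-order term, the measures \<open>\<epsilon>\<^sup>-\<^sup>1 \<Delta> \<otimes> \<Delta> ds\<close> have bounded total variation along the
  subsequence, and by (H2) their primitives converge to \<open>V\<close> when tested against a fixed
  element of the Chi-subspace. The integrand \<open>s \<mapsto> D\<^sup>2F(s, X\<^sub>s)\<close> is continuous, hence a uniform limit of
  step functions, and the bound allows the two limits to be interchanged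
  (\<open>stieltjes_sums_limit\<close>).

  Two points need care. The null sets in (H2) depend on the tested element and on time,
  and the Chi-subspace may be nonseparable. But \<open>D\<^sup>2F\<close> has a separable range, because \<open>B\<close> is separable and
  \<open>D\<^sup>2F\<close> is continuous, so step functions with values in one fixed countable set \<open>C\<close> and with rational
  break points suffice, and one null set serves all of them. Secondly, the argument gives almost
  sure limits along subsequences only. The step functions are therefore selected for each path
  once and for all, which makes the limit independent of the subsequence; a subsequence of any
  sequence \<open>\<epsilon>\<^sub>n\<close> that decreases to zero then leads to the same limit, and this is convergence
  in probability (\<open>converges_in_probability_at_right_0I\<close>).\<close>

section \<open>Integrals against densities\<close>

text \<open>A density \<open>k\<close> with mass at most \<open>K\<close> controls every integrand of size \<open>e * k\<close>. The left endpoint is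
  exempt since step functions built from intervals \<open>{c<..d}\<close> vanish there.\<close>

lemma abs_set_integral_le_density:
  fixes f k :: "real \<Rightarrow> real"
  assumes f: "set_integrable lborel {a..b} f"
    and k: "continuous_on {a..b} k"
    and K: "(\<integral>\<^sup>+s\<in>{a..b}. ennreal (k s) \<partial>lborel) \<le> ennreal K" "0 \<le> K"
    and e: "0 \<le> e"
    and le: "\<And>s. s \<in> {a<..b} \<Longrightarrow> \<bar>f s\<bar> \<le> e * k s"
  shows "\<bar>LBINT s:{a..b}. f s\<bar> \<le> e * K"
proof -
  have meas: "(\<lambda>s. ennreal (k s) * indicator {a..b} s) \<in> borel_measurable lborel"
  proof -
    have "(\<lambda>s. indicator {a..b} s *\<^sub>R k s) \<in> borel_measurable borel"
      using k by (intro borel_measurable_continuous_on_indicator) auto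
    then have "(\<lambda>s. ennreal (indicator {a..b} s *\<^sub>R k s)) \<in> borel_measurable lborel"
      by simp
    also have "(\<lambda>s. ennreal (indicator {a..b} s *\<^sub>R k s)) = (\<lambda>s. ennreal (k s) * indicator {a..b} s)"
      by (auto simp: indicator_def)
    finally show ?thesis .
  qed
  have "ennreal (norm (LBINT s:{a..b}. f s)) \<le> (\<integral>\<^sup>+s. ennreal (norm (indicator {a..b} s *\<^sub>R f s)) \<partial>lborel)"
    using f unfolding set_lebesgue_integral_def set_integrable_def
    by (rule integral_norm_bound_ennreal)
  also have "\<dots> \<le> (\<integral>\<^sup>+s. ennreal e * (ennreal (k s) * indicator {a..b} s) \<partial>lborel)"
  proof (rule nn_integral_mono_AE)
    have "AE s in lborel. s \<noteq> a" by (rule AE_lborel_singleton)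
    then show "AE s in lborel. ennreal (norm (indicator {a..b} s *\<^sub>R f s))
        \<le> ennreal e * (ennreal (k s) * indicator {a..b} s)"
    proof eventually_elim
      case (elim s)
      show ?case
      proof (cases "s \<in> {a..b}")
        case True
        with elim have "\<bar>f s\<bar> \<le> e * k s" by (intro le) auto
        then show ?thesis using True e
          by (metis (no_types, lifting) abs_ge_zero ennreal_leI ennreal_mult' indicator_simps(1)
              mult.right_neutral real_norm_def scaleR_one)
      qed simp
    qed
  qed
  also have "\<dots> = ennreal e * (\<integral>\<^sup>+s\<in>{a..b}. ennreal (k s) \<partial>lborel)"
    by (rule nn_integral_cmult[OF meas])
  also have "\<dots> \<le> ennreal e * ennreal K"
    by (intro mult_left_mono K) auto
  also have "\<dots> = ennreal (e * K)" using e by (simp add: ennreal_mult')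
  finally show ?thesis using e K by (simp add: ennreal_le_iff)
qed

text \<open>Interchange of limits: the approximation of \<open>I\<close> by \<open>J n\<close> is uniform in \<open>k\<close>, which makes \<open>I\<close> a Cauchy sequence.\<close>

lemma iterated_limit:
  fixes I :: "nat \<Rightarrow> real"
  assumes le: "\<And>n k. \<bar>I k - J n k\<bar> \<le> a n" and a: "a \<longlonglongrightarrow> 0"
    and J: "\<And>n. J n \<longlonglongrightarrow> L n"
  shows "\<exists>S. L \<longlonglongrightarrow> S \<and> I \<longlonglongrightarrow> S"
proof -
  have "Cauchy I"
  proof (rule CauchyI)
    fix e :: real assume "0 < e"
    then have "\<forall>\<^sub>F n in sequentially. a n < e / 4" using a by (intro order_tendstoD(2)) auto
    then obtain n where n: "a n < e / 4" by (auto simp: eventually_sequentially)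
    from LIMSEQ_imp_Cauchy[OF J[of n]] \<open>0 < e\<close>
    obtain N where N: "\<And>i j. i \<ge> N \<Longrightarrow> j \<ge> N \<Longrightarrow> norm (J n i - J n j) < e / 4"
      unfolding Cauchy_iff by (metis zero_less_divide_iff zero_less_numeral)
    have "norm (I i - I j) < e" if "i \<ge> N" "j \<ge> N" for i j
      using le[of i n] le[of j n] N[OF that] n unfolding real_norm_def by linarith
    then show "\<exists>M. \<forall>m\<ge>M. \<forall>n\<ge>M. norm (I m - I n) < e" by blast
  qed
  then obtain S where S: "I \<longlonglongrightarrow> S" using Cauchy_convergent_iff convergentD by blast
  have "\<bar>S - L n\<bar> \<le> a n" for n
    by (rule tendsto_le[OF trivial_limit_sequentially tendsto_const
          tendsto_rabs[OF tendsto_diff[OF S J[of n]]]]) (simp add: le)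
  then have "L \<longlonglongrightarrow> S"
    using a by (intro LIM_zero_cancel[of L S] Lim_null_comparison[of "\<lambda>n. L n - S" a])
      (auto simp: abs_minus_commute)
  with S show ?thesis by blast
qed

lemma set_integral_step_fun:
  fixes m :: "real \<Rightarrow> 'c::real_normed_vector \<Rightarrow>\<^sub>L real"
  assumes m: "continuous_on {0..t} m"
    and ps: "\<forall>(c, d, \<phi>)\<in>set ps. 0 \<le> c \<and> c \<le> d \<and> d \<le> t"
  shows "set_integrable lborel {0..t} (\<lambda>s. m s (step_fun ps s)) \<and>
    (LBINT s:{0..t}. m s (step_fun ps s)) =
      (\<Sum>(c, d, \<phi>)\<leftarrow>ps. (LBINT s:{0..d}. m s \<phi>) - (LBINT s:{0..c}. m s \<phi>))"
  using ps
proof (induction ps)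
  case Nil
  then show ?case by (simp add: step_fun_def set_integrable_def set_lebesgue_integral_def)
next
  case (Cons p ps)
  obtain c d \<phi> where p: "p = (c, d, \<phi>)" by (cases p)
  with Cons.prems have cd: "0 \<le> c" "c \<le> d" "d \<le> t" by auto
  have int: "set_integrable lborel {0..t} (\<lambda>s. m s \<phi>)"
    by (intro borel_integrable_atLeastAtMost' continuous_intros m)
  have int1: "set_integrable lborel {c<..d} (\<lambda>s. m s \<phi>)"
    by (rule set_integrable_subset[OF int]) (use cd in auto)
  have ind: "indicator {0..t} s *\<^sub>R (indicat_real {c<..d} s * m s \<phi>) = indicator {c<..d} s *\<^sub>R m s \<phi>" for s
    using cd by (auto simp: indicator_def)
  have int2: "set_integrable lborel {0..t} (\<lambda>s. indicat_real {c<..d} s * m s \<phi>)"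
    using int1 unfolding set_integrable_def ind .
  have "(LBINT s:{0..d}. m s \<phi>) = (LBINT s:{0..c} \<union> {c<..d}. m s \<phi>)"
    using cd by (intro arg_cong[where f="\<lambda>A. LBINT s:A. m s \<phi>"]) auto
  also have "\<dots> = (LBINT s:{0..c}. m s \<phi>) + (LBINT s:{c<..d}. m s \<phi>)"
    by (intro set_integral_Un set_integrable_subset[OF int]) (use cd in auto)
  finally have eq: "(LBINT s:{0..t}. indicat_real {c<..d} s * m s \<phi>) =
      (LBINT s:{0..d}. m s \<phi>) - (LBINT s:{0..c}. m s \<phi>)"
    unfolding set_lebesgue_integral_def ind by simp
  have ms: "m s (step_fun (p # ps) s) = indicat_real {c<..d} s * m s \<phi> + m s (step_fun ps s)" for s
    by (simp add: p step_fun_def blinfun.add_right blinfun.scaleR_right)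
  have IH: "set_integrable lborel {0..t} (\<lambda>s. m s (step_fun ps s))"
    "(LBINT s:{0..t}. m s (step_fun ps s)) =
      (\<Sum>(c, d, \<phi>)\<leftarrow>ps. (LBINT s:{0..d}. m s \<phi>) - (LBINT s:{0..c}. m s \<phi>))"
    using Cons by auto
  show ?case
    unfolding ms using set_integral_add[OF int2 IH(1)] eq IH(2) by (simp add: p)
qed

text \<open>Convergence of vector measures \<open>m k s ds\<close> of bounded mass: convergence of the primitives, tested
  against the finitely many values of each step function, gives convergence of the integrals of \<open>g\<close>,
  and the limit is the Stieltjes integral of \<open>g\<close>. The existence of the limit of the
  elementary integrals is part of the conclusion, inherited from the approximating measures.\<close>

lemma stieltjes_sums_limit:
  fixes m :: "nat \<Rightarrow> real \<Rightarrow> 'c::real_normed_vector \<Rightarrow>\<^sub>L real" and v :: "real \<Rightarrow> 'c \<Rightarrow>\<^sub>L real"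
  assumes m: "\<And>k. continuous_on {0..t} (m k)"
    and K: "\<And>k. (\<integral>\<^sup>+s\<in>{0..t}. ennreal (norm (m k s)) \<partial>lborel) \<le> ennreal K" "0 \<le> K"
    and g: "continuous_on {0..t} g"
    and ps: "\<And>n. \<forall>(c, d, \<phi>)\<in>set (ps n). 0 \<le> c \<and> c \<le> d \<and> d \<le> t"
    and err: "\<And>n s. s \<in> {0<..t} \<Longrightarrow> norm (step_fun (ps n) s - g s) \<le> e n"
    and e: "\<And>n. 0 \<le> e n" "e \<longlonglongrightarrow> 0"
    and lim: "\<And>n c d \<phi>. (c, d, \<phi>) \<in> set (ps n) \<Longrightarrow>
        (\<lambda>k. LBINT s:{0..c}. m k s \<phi>) \<longlonglongrightarrow> v c \<phi> \<and> (\<lambda>k. LBINT s:{0..d}. m k s \<phi>) \<longlonglongrightarrow> v d \<phi>"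
  shows "\<exists>S. (\<lambda>n. step_integral v (ps n)) \<longlonglongrightarrow> S \<and> (\<lambda>k. LBINT s:{0..t}. m k s (g s)) \<longlonglongrightarrow> S"
proof (rule iterated_limit)
  note step = set_integral_step_fun[OF m ps]
  show "(\<lambda>n. e n * K) \<longlonglongrightarrow> 0" using tendsto_mult_left_zero[OF e(2)] .
  show "\<bar>(LBINT s:{0..t}. m k s (g s)) - (LBINT s:{0..t}. m k s (step_fun (ps n) s))\<bar> \<le> e n * K" for n k
  proof -
    have int: "set_integrable lborel {0..t} (\<lambda>s. m k s (g s))"
      by (intro borel_integrable_atLeastAtMost' continuous_intros m g)
    have "\<bar>LBINT s:{0..t}. m k s (g s) - m k s (step_fun (ps n) s)\<bar> \<le> e n * K"
    proof (rule abs_set_integral_le_density[OF _ _ K e(1)])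
      show "continuous_on {0..t} (\<lambda>s. norm (m k s))" by (intro continuous_intros m)
      fix s assume "s \<in> {0<..t}"
      have "\<bar>m k s (g s) - m k s (step_fun (ps n) s)\<bar> = norm (m k s (step_fun (ps n) s - g s))"
        by (simp add: blinfun.diff_right abs_minus_commute)
      also have "\<dots> \<le> norm (m k s) * norm (step_fun (ps n) s - g s)" by (rule norm_blinfun)
      also have "\<dots> \<le> norm (m k s) * e n" by (intro mult_left_mono err) (use \<open>s \<in> _\<close> in auto)
      finally show "\<bar>m k s (g s) - m k s (step_fun (ps n) s)\<bar> \<le> e n * norm (m k s)"
        by (simp add: mult.commute)
    qed (use int step[of k n] in \<open>simp\<close>)
    then show ?thesis using int step[of k n] by (subst (asm) set_integral_diff) auto
  qed
  show "(\<lambda>k. LBINT s:{0..t}. m k s (step_fun (ps n) s)) \<longlonglongrightarrow> step_integral v (ps n)" for n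
  proof -
    have "(\<lambda>k. \<Sum>(c, d, \<phi>)\<leftarrow>qs. (LBINT s:{0..d}. m k s \<phi>) - (LBINT s:{0..c}. m k s \<phi>))
        \<longlonglongrightarrow> step_integral v qs" if "set qs \<subseteq> set (ps n)" for qs
      using that
    proof (induction qs)
      case (Cons q qs)
      obtain c d \<phi> where q: "q = (c, d, \<phi>)" by (cases q)
      have "(c, d, \<phi>) \<in> set (ps n)" using Cons.prems q by auto
      from lim[OF this] have "(\<lambda>k. (LBINT s:{0..d}. m k s \<phi>) - (LBINT s:{0..c}. m k s \<phi>)) \<longlonglongrightarrow> (v d - v c) \<phi>"
        by (auto intro!: tendsto_diff simp: blinfun.diff_left)
      from tendsto_add[OF this Cons.IH] Cons.prems q show ?case
        by (simp add: step_integral_def)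
    qed (simp add: step_integral_def)
    then show ?thesis using step[of _ n] by simp
  qed
qed

section \<open>The Stieltjes integral of a continuous integrand\<close>

text \<open>The interval measure of \<open>F\<close> is defined as an extension of \<open>{a<..b} \<mapsto> F b - F a\<close> if there is one, and as
  the zero measure otherwise; the bound holds in both cases. It serves to see that \<open>|dv|\<close> has
  finite mass.\<close>

lemma emeasure_interval_measure_Ioc_le:
  assumes "a \<le> b"
  shows "emeasure (interval_measure F) {a<..b} \<le> ennreal (F b - F a)"
proof -
  let ?I = "{(a, b). a \<le> (b::real)}" and ?G = "\<lambda>(a, b). {a<..b}"
  let ?\<mu> = "\<lambda>(a, b). ennreal (F b - F a)"
  let ?P = "\<lambda>\<mu>'. (\<forall>i\<in>?I. \<mu>' (?G i) = ?\<mu> i) \<and> measure_space UNIV (sigma_sets UNIV (?G ` ?I)) \<mu>'"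
  show ?thesis
  proof (cases "(\<exists>\<mu>'. ?P \<mu>') \<and> \<not> (\<forall>i\<in>?I. ?\<mu> i = 0)")
    case True
    then have "interval_measure F = measure_of UNIV (?G ` ?I) (SOME \<mu>'. ?P \<mu>')"
      unfolding interval_measure_def extend_measure_def by (rule if_P)
    moreover have "?P (SOME \<mu>'. ?P \<mu>')" using True by (intro someI_ex[of ?P]) blast
    ultimately show ?thesis using assms by (auto simp: emeasure_measure_of_conv)
  next
    case False
    then have "interval_measure F = measure_of UNIV (?G ` ?I) (\<lambda>_. 0)"
      unfolding interval_measure_def extend_measure_def by (rule if_not_P)
    then show ?thesis by (simp add: emeasure_measure_of_conv)
  qed
qed

lemma has_stieltjes_integral_uniform_limit:
  fixes v :: "real \<Rightarrow> 'c::real_normed_vector \<Rightarrow>\<^sub>L real"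
  assumes ab: "a \<le> b"
    and ps: "\<And>n. \<forall>(c, d, \<phi>)\<in>set (ps n). a \<le> c \<and> c \<le> d \<and> d \<le> b"
    and err: "\<And>n s. s \<in> {a<..b} \<Longrightarrow> norm (step_fun (ps n) s - g s) \<le> e n"
    and e: "e \<longlonglongrightarrow> 0"
    and S: "(\<lambda>n. step_integral v (ps n)) \<longlonglongrightarrow> S"
  shows "has_stieltjes_integral a b g v S"
  unfolding has_stieltjes_integral_def
proof (intro exI[of _ ps] conjI ps allI S)
  let ?M = "variation_measure a b v"
  have "(\<lambda>n. step_fun (ps n) x) \<longlonglongrightarrow> g x" if "x \<in> {a<..b}" for x
    by (rule LIM_zero_cancel, rule Lim_null_comparison[OF always_eventually e]) (use err that in auto)
  then show "AE x in ?M. x \<in> {a<..b} \<longrightarrow> (\<lambda>n. step_fun (ps n) x) \<longlonglongrightarrow> g x" by simp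
  obtain c where c: "emeasure ?M {a<..b} \<le> ennreal c" "0 \<le> c"
    unfolding variation_measure_def
    by (metis (no_types, lifting) emeasure_interval_measure_Ioc_le[OF ab] ennreal_neg nle_le order_refl order_trans)
  have sets: "{a<..b} \<in> sets ?M" by (simp add: variation_measure_def)
  have le: "(\<integral>\<^sup>+x\<in>{a<..b}. ennreal (norm (step_fun (ps n) x - g x)) \<partial>?M) \<le> ennreal (\<bar>e n\<bar> * c)" for n
  proof -
    have "(\<integral>\<^sup>+x\<in>{a<..b}. ennreal (norm (step_fun (ps n) x - g x)) \<partial>?M)
        \<le> (\<integral>\<^sup>+x. ennreal \<bar>e n\<bar> * indicator {a<..b} x \<partial>?M)"
    proof (rule nn_integral_mono)
      fix x
      show "ennreal (norm (step_fun (ps n) x - g x)) * indicator {a<..b} x \<le> ennreal \<bar>e n\<bar> * indicator {a<..b} x"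
        using err[of x n] by (cases "x \<in> {a<..b}") (auto intro!: ennreal_leI)
    qed
    also have "\<dots> = ennreal \<bar>e n\<bar> * emeasure ?M {a<..b}" by (rule nn_integral_cmult_indicator[OF sets])
    also have "\<dots> \<le> ennreal \<bar>e n\<bar> * ennreal c" by (intro mult_left_mono c) auto
    finally show ?thesis by (simp add: ennreal_mult')
  qed
  have "(\<lambda>n. \<bar>e n\<bar> * c) \<longlonglongrightarrow> 0" using e by (intro tendsto_mult_left_zero tendsto_rabs_zero)
  then have "(\<lambda>n. ennreal (\<bar>e n\<bar> * c)) \<longlonglongrightarrow> 0"
    using tendsto_ennrealI ennreal_0 by metis
  then show "(\<lambda>n. \<integral>\<^sup>+x\<in>{a<..b}. ennreal (norm (step_fun (ps n) x - g x)) \<partial>?M) \<longlonglongrightarrow> 0"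
    by (rule tendsto_sandwich[OF _ _ tendsto_const, rotated 2]) (use le in auto)
qed

text \<open>A countable set of break points that contains, with \<open>0\<close> and \<open>t\<close>,
  all equidistant partitions of \<open>[0, t]\<close>.\<close>

definition grid :: "real \<Rightarrow> real set" where
  "grid t = range (\<lambda>(i::nat, m::nat). t * real i / real (Suc m))"

lemma countable_grid: "countable (grid t)"
  unfolding grid_def by (intro countable_image) simp

text \<open>Uniform continuity on the equidistant partitions of small mesh; on each cell the value at its right
  endpoint is replaced by a nearby element of \<open>C\<close>.\<close>

lemma step_approximation:
  fixes g :: "real \<Rightarrow> 'c::real_normed_vector"
  assumes t: "0 \<le> t" and g: "continuous_on {0..t} g" and e: "0 < e"
    and C: "\<And>s d. s \<in> {0..t} \<Longrightarrow> 0 < d \<Longrightarrow> \<exists>\<phi>\<in>C. norm (\<phi> - g s) < d"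
  shows "\<exists>ps. (\<forall>(c, d, \<phi>)\<in>set ps. 0 \<le> c \<and> c \<le> d \<and> d \<le> t \<and> c \<in> grid t \<and> d \<in> grid t \<and> \<phi> \<in> C) \<and>
    (\<forall>s\<in>{0<..t}. norm (step_fun ps s - g s) \<le> e)"
proof -
  have "uniformly_continuous_on {0..t} g" using g by (intro compact_uniformly_continuous) auto
  then obtain d where d: "0 < d" "\<And>s s'. s \<in> {0..t} \<Longrightarrow> s' \<in> {0..t} \<Longrightarrow> dist s' s < d \<Longrightarrow> dist (g s') (g s) < e / 2"
    using e unfolding uniformly_continuous_on_def by (metis half_gt_zero)
  obtain m :: nat where m: "t / d < real (Suc m)" using reals_Archimedean2[of "t / d"] less_Suc_eq_le
    by (metis less_trans of_nat_less_iff lessI)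
  define M where "M = Suc m"
  have M: "0 < M" "t / real M < d" using m d(1) by (auto simp: M_def field_simps)
  define \<tau> where "\<tau> i = t * real i / real M" for i
  have \<tau>_grid: "\<tau> i \<in> grid t" for i unfolding \<tau>_def M_def grid_def by (rule range_eqI[of _ _ "(i, m)"]) simp
  have \<tau>_bounds: "0 \<le> \<tau> i" "\<tau> i \<le> \<tau> (Suc i)" for i using t by (auto simp: \<tau>_def intro!: divide_right_mono mult_left_mono)
  have \<tau>_le: "\<tau> i \<le> t" if "i \<le> M" for i
    using that t M(1) by (auto simp: \<tau>_def divide_le_eq intro!: mult_left_mono)
  have "\<exists>\<phi>. \<forall>i. i < M \<longrightarrow> \<phi> i \<in> C \<and> norm (\<phi> i - g (\<tau> (Suc i))) < e / 2"
  proof (intro choice allI)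
    fix i
    show "\<exists>\<phi>. i < M \<longrightarrow> \<phi> \<in> C \<and> norm (\<phi> - g (\<tau> (Suc i))) < e / 2"
      using C[of "\<tau> (Suc i)" "e / 2"] \<tau>_bounds(1)[of "Suc i"] \<tau>_le[of "Suc i"] e by force
  qed
  then obtain \<phi> where \<phi>: "\<And>i. i < M \<Longrightarrow> \<phi> i \<in> C" "\<And>i. i < M \<Longrightarrow> norm (\<phi> i - g (\<tau> (Suc i))) < e / 2"
    by blast
  let ?ps = "map (\<lambda>i. (\<tau> i, \<tau> (Suc i), \<phi> i)) [0..<M]"
  show ?thesis
  proof (intro exI[of _ ?ps] conjI ballI)
    fix p assume "p \<in> set ?ps"
    then show "case p of (c, d, \<phi>) \<Rightarrow> 0 \<le> c \<and> c \<le> d \<and> d \<le> t \<and> c \<in> grid t \<and> d \<in> grid t \<and> \<phi> \<in> C"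
      using \<tau>_bounds \<tau>_le \<tau>_grid \<phi>(1) by auto
  next
    fix s assume s: "s \<in> {0<..t}"
    then have t0: "0 < t" by auto
    \<comment> \<open>The index of the only cell \<open>{\<tau> i<..\<tau> (Suc i)}\<close> that contains \<open>s\<close>.\<close>
    define i where "i = nat (\<lceil>s * real M / t\<rceil> - 1)"
    have pos: "0 < s * real M / t" "s * real M / t \<le> real M" using s t0 M(1) by (auto simp: field_simps)
    then have ceil: "\<lceil>s * real M / t\<rceil> = int i + 1" and "i < M"
      unfolding i_def by (auto simp: ceiling_le_iff) linarith+
    have ind: "s \<in> {\<tau> j<..\<tau> (Suc j)} \<longleftrightarrow> j = i" for j
    proof -
      have "s \<in> {\<tau> j<..\<tau> (Suc j)} \<longleftrightarrow> real j < s * real M / t \<and> s * real M / t \<le> real j + 1"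
        using t0 M(1) by (auto simp: \<tau>_def field_simps)
      also have "\<dots> \<longleftrightarrow> \<lceil>s * real M / t\<rceil> = int j + 1" by (simp add: ceiling_eq_iff)
      finally show ?thesis using ceil by auto
    qed
    have "step_fun ?ps s = (\<Sum>j<M. indicat_real {\<tau> j<..\<tau> (Suc j)} s *\<^sub>R \<phi> j)"
      by (simp add: step_fun_def o_def interv_sum_list_conv_sum_set_nat lessThan_atLeast0)
    also have "\<dots> = (\<Sum>j<M. if j = i then \<phi> j else 0)"
      by (intro sum.cong refl) (use ind in \<open>simp add: indicator_def\<close>)
    also have "\<dots> = \<phi> i" using \<open>i < M\<close> by simp
    finally have sf: "step_fun ?ps s = \<phi> i" .
    have si: "\<tau> i < s" "s \<le> \<tau> (Suc i)" using ind[of i] by auto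
    have "\<tau> (Suc i) - \<tau> i = t / real M" by (simp add: \<tau>_def field_simps add_divide_distrib)
    with si M(2) have "dist (\<tau> (Suc i)) s < d" by (simp add: dist_real_def)
    then have "norm (g (\<tau> (Suc i)) - g s) < e / 2"
      using d(2)[of s "\<tau> (Suc i)"] s \<tau>_bounds(1)[of "Suc i"] \<tau>_le[of "Suc i"] \<open>i < M\<close> by (simp add: dist_norm)
    then show "norm (step_fun ?ps s - g s) \<le> e"
      unfolding sf using \<phi>(2)[OF \<open>i < M\<close>] norm_triangle_ineq[of "\<phi> i - g (\<tau> (Suc i))" "g (\<tau> (Suc i)) - g s"]
      by simp
  qed
qed

text \<open>The range of a continuous function on the separable space \<open>[0, T] \<times> B\<close> is separable, even in
  a nonseparable target.\<close>

lemma countable_dense_in_range: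
  fixes G :: "real \<Rightarrow> 'b::{real_normed_vector, second_countable_topology} \<Rightarrow> 'c::real_normed_vector"
  assumes G: "continuous_on ({0..T} \<times> UNIV) (\<lambda>(s, \<eta>). G s \<eta>)"
  obtains C where "countable C"
    "\<And>s \<eta> d. s \<in> {0..T} \<Longrightarrow> 0 < d \<Longrightarrow> \<exists>\<phi>\<in>C. norm (\<phi> - G s \<eta>) < d"
proof -
  obtain D :: "(real \<times> 'b) set" where D: "countable D" "D \<subseteq> {0..T} \<times> UNIV" "{0..T} \<times> UNIV \<subseteq> closure D"
    using separable by blast
  let ?G = "\<lambda>(s, \<eta>). G s \<eta>"
  show thesis
  proof (rule that[of "?G ` D"])
    fix s \<eta> and d :: real assume s: "s \<in> {0..T}" and d: "0 < d"
    then have "(s, \<eta>) \<in> closure D" using D(3) by blast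
    then obtain q where q: "\<And>n. q n \<in> D" "q \<longlonglongrightarrow> (s, \<eta>)" by (auto simp: closure_sequential)
    have "(\<lambda>n. ?G (q n)) \<longlonglongrightarrow> ?G (s, \<eta>)"
      by (rule continuous_on_tendsto_compose[OF G q(2)])
        (use s q(1) D(2) in \<open>blast intro: always_eventually\<close>)+
    from eventually_happens[OF tendstoD[OF this d]] q(1)
    show "\<exists>\<phi>\<in>?G ` D. norm (\<phi> - G s \<eta>) < d" by (auto simp: dist_norm)
  qed (use D(1) in simp)
qed

section \<open>Calculus along a continuous path\<close>

text \<open>Time cut off to \<open>[0, T]\<close>, as in the extension of processes by constants.\<close>

abbreviation clip :: "real \<Rightarrow> real \<Rightarrow> real" where
  "clip T s \<equiv> max 0 (min T s)"

lemma continuous_on_time_space: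
  assumes "continuous_on ({0..T} \<times> UNIV) (\<lambda>(s, \<eta>). G s \<eta>)"
    and "continuous_on A f" "continuous_on A g" "\<And>z. z \<in> A \<Longrightarrow> f z \<in> {0..T}"
  shows "continuous_on A (\<lambda>z. G (f z) (g z))"
proof -
  have "continuous_on A (\<lambda>z. (\<lambda>(s, \<eta>). G s \<eta>) (f z, g z))"
    by (rule continuous_on_compose2[OF assms(1)]) (use assms in \<open>auto intro!: continuous_intros\<close>)
  then show ?thesis by simp
qed

lemma frechet_C12_D:
  assumes "frechet_C12 T F F\<^sub>t DF D2F"
  shows "\<And>t \<eta>. t \<in> {0..T} \<Longrightarrow> (F t has_derivative blinfun_apply (DF t \<eta>)) (at \<eta>)"
    and "\<And>t \<eta>. t \<in> {0..T} \<Longrightarrow> ((\<lambda>s. F s \<eta>) has_derivative (\<lambda>h. h * F\<^sub>t t \<eta>)) (at t within {0..T})"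
    and "\<And>t \<eta>. t \<in> {0..T} \<Longrightarrow> (DF t has_derivative blinfun_apply (D2F t \<eta>)) (at \<eta>)"
    and "continuous_on ({0..T} \<times> UNIV) (\<lambda>(t, \<eta>). F t \<eta>)"
    and "continuous_on ({0..T} \<times> UNIV) (\<lambda>(t, \<eta>). F\<^sub>t t \<eta>)"
    and "continuous_on ({0..T} \<times> UNIV) (\<lambda>(t, \<eta>). DF t \<eta>)"
proof -
  have D: "((\<lambda>(s, \<xi>). F s \<xi>) has_derivative (\<lambda>(h, k). h * F\<^sub>t t \<eta> + DF t \<eta> k))
        (at (t, \<eta>) within {0..T} \<times> UNIV)" if "t \<in> {0..T}" for t \<eta>
    using assms that unfolding frechet_C12_def by blast
  show "(F t has_derivative blinfun_apply (DF t \<eta>)) (at \<eta>)" if t: "t \<in> {0..T}" for t \<eta>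
  proof -
    have "((\<lambda>\<xi>. (\<lambda>(s, \<xi>). F s \<xi>) (t, \<xi>)) has_derivative
        (\<lambda>k. (\<lambda>(h, k). h * F\<^sub>t t \<eta> + DF t \<eta> k) (0, k))) (at \<eta> within UNIV)"
      by (rule has_derivative_in_compose)
        (use t in \<open>auto intro!: derivative_eq_intros has_derivative_subset[OF D[OF t]]\<close>)
    then show ?thesis by simp
  qed
  show "((\<lambda>s. F s \<eta>) has_derivative (\<lambda>h. h * F\<^sub>t t \<eta>)) (at t within {0..T})" if t: "t \<in> {0..T}" for t \<eta>
  proof -
    have "((\<lambda>s. (\<lambda>(s, \<xi>). F s \<xi>) (s, \<eta>)) has_derivative
        (\<lambda>h. (\<lambda>(h, k). h * F\<^sub>t t \<eta> + DF t \<eta> k) (h, 0))) (at t within {0..T})"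
      by (rule has_derivative_in_compose)
        (use t in \<open>auto intro!: derivative_eq_intros has_derivative_subset[OF D[OF t]]\<close>)
    then show ?thesis by (simp add: blinfun.zero_right)
  qed
  show "continuous_on ({0..T} \<times> UNIV) (\<lambda>(t, \<eta>). F t \<eta>)"
    unfolding continuous_on_eq_continuous_within
    using D has_derivative_continuous by fastforce
qed (use assms in \<open>auto simp: frechet_C12_def\<close>)

text \<open>In terms of a primitive \<open>\<Phi>\<close> of \<open>f\<close> the integral is the difference of the difference quotients of \<open>\<Phi>\<close>
  at \<open>t\<close> and at \<open>0\<close>.\<close>

lemma integral_difference_quotient_tendsto:
  fixes f :: "real \<Rightarrow> real"
  assumes f: "continuous_on UNIV f" and t: "0 \<le> t"
    and \<epsilon>: "\<And>k::nat. 0 < \<epsilon> k" "\<epsilon> \<longlonglongrightarrow> 0"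
  shows "(\<lambda>k. LBINT s:{0..t}. (f (s + \<epsilon> k) - f s) / \<epsilon> k) \<longlonglongrightarrow> f t - f 0"
proof -
  \<comment> \<open>The interval contains \<open>[0, t + 1]\<close> in its interior, so the primitive is differentiable there.\<close>
  have "continuous_on {-1..t + 2} f" using f continuous_on_subset by blast
  then obtain \<Phi> where \<Phi>: "\<And>x. x \<in> {-1..t+2} \<Longrightarrow> (\<Phi> has_vector_derivative f x) (at x within {-1..t+2})"
    using antiderivative_continuous by blast
  have D: "(\<Phi> has_real_derivative f x) (at x)" if "-1 < x" "x < t + 2" for x
    using \<Phi>[of x] that at_within_Icc_at[of "-1" x "t+2"]
    by (simp add: has_real_derivative_iff_has_vector_derivative)
  have q: "(\<lambda>k. (\<Phi> (x + \<epsilon> k) - \<Phi> x) / \<epsilon> k) \<longlonglongrightarrow> f x" if "-1 < x" "x < t + 2" for x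
  proof -
    have "((\<lambda>h. (\<Phi> (x + h) - \<Phi> x) / h) \<longlongrightarrow> f x) (at 0)"
      using D[OF that] by (simp add: DERIV_def)
    moreover have "filterlim \<epsilon> (at 0) sequentially"
      using \<epsilon> by (auto simp: filterlim_at intro!: always_eventually less_imp_neq[symmetric])
    ultimately show ?thesis by (rule filterlim_compose)
  qed
  have "\<forall>\<^sub>F k in sequentially. \<epsilon> k < 1" using \<epsilon>(2) by (intro order_tendstoD(2)) auto
  then have ev: "\<forall>\<^sub>F k in sequentially. (\<Phi> (t + \<epsilon> k) - \<Phi> t) / \<epsilon> k - (\<Phi> (0 + \<epsilon> k) - \<Phi> 0) / \<epsilon> k =
      (LBINT s:{0..t}. (f (s + \<epsilon> k) - f s) / \<epsilon> k)"
  proof eventually_elim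
    case (elim k)
    have "(LBINT s:{0..t}. (f (s + \<epsilon> k) - f s) / \<epsilon> k) =
      (\<Phi> (t + \<epsilon> k) - \<Phi> t) / \<epsilon> k - (\<Phi> (0 + \<epsilon> k) - \<Phi> 0) / \<epsilon> k"
      unfolding set_lebesgue_integral_def
    proof (rule integral_FTC_atLeastAtMost[OF t, of "\<lambda>s. (\<Phi> (s + \<epsilon> k) - \<Phi> s) / \<epsilon> k"])
      fix s assume s: "0 \<le> s" "s \<le> t"
      have "((\<lambda>s. \<Phi> (s + \<epsilon> k)) has_real_derivative f (s + \<epsilon> k)) (at s)"
        using D[of "s + \<epsilon> k"] s elim \<epsilon>(1)[of k] by (simp add: DERIV_shift)
      then have "((\<lambda>s. (\<Phi> (s + \<epsilon> k) - \<Phi> s) / \<epsilon> k) has_real_derivative (f (s + \<epsilon> k) - f s) / \<epsilon> k) (at s)"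
        using D[of s] s by (intro DERIV_cdivide DERIV_diff) auto
      then show "((\<lambda>s. (\<Phi> (s + \<epsilon> k) - \<Phi> s) / \<epsilon> k) has_vector_derivative (f (s + \<epsilon> k) - f s) / \<epsilon> k) (at s within {0..t})"
        unfolding has_real_derivative_iff_has_vector_derivative
        by (rule has_vector_derivative_at_within)
    next
      show "continuous_on {0..t} (\<lambda>s. (f (s + \<epsilon> k) - f s) / \<epsilon> k)"
        using \<epsilon>(1)[of k] by (intro continuous_intros continuous_on_compose2[OF f] continuous_on_subset[OF f]) auto
    qed
    then show ?case by simp
  qed
  show ?thesis
    by (rule Lim_transform_eventually[OF _ ev]) (intro tendsto_diff q, use t in auto)
qed

lemma chi_tensor_apply:
  "chi_tensor \<iota> x y \<phi> = \<iota> \<phi> x y"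
  by (simp add: chi_tensor_def)

lemma continuous_on_chi_tensor:
  fixes f :: "real \<Rightarrow> 'b::real_normed_vector" and \<iota> :: "'c::real_normed_vector \<Rightarrow>\<^sub>L 'b \<Rightarrow>\<^sub>L 'b \<Rightarrow>\<^sub>L real"
  assumes "continuous_on A f"
  shows "continuous_on A (\<lambda>s. chi_tensor \<iota> (f s) (f s))"
proof -
  have bil: "bounded_bilinear (tensor :: 'b \<Rightarrow> 'b \<Rightarrow> _)"
  proof (rule bounded_bilinear.intro)
    show "\<exists>K. \<forall>x y::'b. norm (tensor x y) \<le> norm x * norm y * K"
    proof (intro exI allI)
      fix x y :: 'b
      show "norm (tensor x y) \<le> norm x * norm y * 1"
      proof (rule norm_blinfun_bound)
        fix \<beta> :: "'b \<Rightarrow>\<^sub>L 'b \<Rightarrow>\<^sub>L real"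
        have "norm (\<beta> x y) \<le> norm (\<beta> x) * norm y" by (rule norm_blinfun)
        also have "\<dots> \<le> (norm \<beta> * norm x) * norm y" by (intro mult_right_mono norm_blinfun) auto
        finally show "norm (tensor x y \<beta>) \<le> norm x * norm y * 1 * norm \<beta>" by (simp add: ac_simps)
      qed simp
    qed
  qed (auto intro!: blinfun_eqI simp: blinfun.bilinear_simps)
  show ?thesis unfolding chi_tensor_def
    by (intro continuous_intros bounded_bilinear.continuous_on[OF bil] assms)
qed

lemma second_order_taylor:
  fixes F :: "'b::real_normed_vector \<Rightarrow> real"
  assumes D1: "\<And>x. (F has_derivative blinfun_apply (DF x)) (at x)"
    and D2: "\<And>x. (DF has_derivative blinfun_apply (D2F x)) (at x)"
  shows "\<exists>a\<in>{0..1}. F (x + h) - F x = DF x h + 1 / 2 * D2F (x + a *\<^sub>R h) h h"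
proof -
  have d1: "((\<lambda>a. F (x + a *\<^sub>R h)) has_real_derivative DF (x + a *\<^sub>R h) h) (at a)" for a
  proof -
    have "((\<lambda>a. F (x + a *\<^sub>R h)) has_derivative (\<lambda>b. DF (x + a *\<^sub>R h) (b *\<^sub>R h))) (at a)"
      by (rule has_derivative_compose[OF _ D1]) (auto intro!: derivative_eq_intros)
    then show ?thesis
      by (rule has_derivative_imp_has_field_derivative) (simp add: blinfun.scaleR_right mult.commute)
  qed
  have d2: "((\<lambda>a. DF (x + a *\<^sub>R h) h) has_real_derivative D2F (x + a *\<^sub>R h) h h) (at a)" for a
  proof -
    have "((\<lambda>a. DF (x + a *\<^sub>R h)) has_derivative (\<lambda>b. D2F (x + a *\<^sub>R h) (b *\<^sub>R h))) (at a)"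
      by (rule has_derivative_compose[OF _ D2]) (auto intro!: derivative_eq_intros)
    then have "((\<lambda>a. DF (x + a *\<^sub>R h) h) has_derivative (\<lambda>b. D2F (x + a *\<^sub>R h) (b *\<^sub>R h) h)) (at a)"
      by (rule bounded_linear.has_derivative[OF blinfun.bounded_linear_left])
    then show ?thesis
      by (rule has_derivative_imp_has_field_derivative)
        (simp add: blinfun.scaleR_right blinfun.scaleR_left mult.commute)
  qed
  let ?diff = "\<lambda>(n::nat) a. if n = 0 then F (x + a *\<^sub>R h) else if n = 1 then DF (x + a *\<^sub>R h) h
      else D2F (x + a *\<^sub>R h) h h"
  have "\<exists>a>0. a < 1 \<and> F (x + 1 *\<^sub>R h) = (\<Sum>m<2. ?diff m 0 / fact m * 1 ^ m) + ?diff 2 a / fact 2 * 1 ^ 2"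
    by (rule Maclaurin) (use d1 d2 in \<open>auto simp: less_2_cases_iff\<close>)
  then obtain a where "0 < a" "a < 1"
    "F (x + h) = F x + DF x h + D2F (x + a *\<^sub>R h) h h / 2"
    by (auto simp: numeral_2_eq_2)
  then show ?thesis by (intro bexI[of _ a]) auto
qed

text \<open>The segments between any two points of the path fill a compact set, on which \<open>G\<close> is uniformly
  continuous.\<close>

lemma uniform_modulus_along_path:
  fixes G :: "real \<Rightarrow> 'b::real_normed_vector \<Rightarrow> 'c::real_normed_vector"
  assumes T: "0 \<le> T" and G: "continuous_on ({0..T} \<times> UNIV) (\<lambda>(s, \<eta>). G s \<eta>)"
    and x: "continuous_on {0..T} x" and e: "0 < e"
  shows "\<exists>d>0. \<forall>s\<in>{0..T}. \<forall>u\<in>{0..T}. \<forall>a\<in>{0..1}. \<bar>u - s\<bar> < d \<longrightarrow>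
    norm (G s (x s + a *\<^sub>R (x u - x s)) - G s (x s)) < e"
proof -
  let ?H = "\<lambda>z. G (fst z) (x (fst z) + snd (snd z) *\<^sub>R (x (fst (snd z)) - x (fst z)))"
  let ?A = "{0..T} \<times> {0..T} \<times> {0..1::real}"
  have "continuous_on ?A ?H"
    by (intro continuous_on_time_space[OF G] continuous_intros continuous_on_compose2[OF x]) auto
  then have "uniformly_continuous_on ?A ?H"
    by (intro compact_uniformly_continuous compact_Times) auto
  then obtain d where d: "0 < d"
    "\<And>z z'. z \<in> ?A \<Longrightarrow> z' \<in> ?A \<Longrightarrow> dist z' z < d \<Longrightarrow> dist (?H z') (?H z) < e"
    using e unfolding uniformly_continuous_on_def by metis
  show ?thesis
  proof (intro exI[of _ d] conjI ballI impI)
    fix s u a :: real assume *: "s \<in> {0..T}" "u \<in> {0..T}" "a \<in> {0..1}" "\<bar>u - s\<bar> < d"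
    have "dist (s, u, a) (s, s, a) < d" using * by (simp add: dist_Pair_Pair dist_real_def)
    from d(2)[OF _ _ this] * show "norm (G s (x s + a *\<^sub>R (x u - x s)) - G s (x s)) < e"
      by (simp add: dist_norm)
  qed (use d in auto)
qed

text \<open>By the mean value theorem the quotients are values of \<open>F\<^sub>t\<close> at times between \<open>s\<close> and \<open>s + \<epsilon> k\<close>, at
  least while \<open>s + \<epsilon> k \<le> T\<close>; beyond \<open>T\<close> the cut-off only makes them smaller. They are therefore bounded, and
  they converge pointwise except possibly at \<open>s = T\<close>, so dominated convergence applies.\<close>

lemma time_increments_tendsto:
  fixes x :: "real \<Rightarrow> 'b::real_normed_vector" and F F\<^sub>t :: "real \<Rightarrow> 'b \<Rightarrow> real"
  assumes T: "0 < T" and t: "t \<in> {0..T}" and x: "continuous_on {0..T} x"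
    and F: "continuous_on ({0..T} \<times> UNIV) (\<lambda>(s, \<eta>). F s \<eta>)"
    and Ft: "continuous_on ({0..T} \<times> UNIV) (\<lambda>(s, \<eta>). F\<^sub>t s \<eta>)"
    and D: "\<And>s \<eta>. s \<in> {0..T} \<Longrightarrow> ((\<lambda>s. F s \<eta>) has_derivative (\<lambda>h. h * F\<^sub>t s \<eta>)) (at s within {0..T})"
    and \<epsilon>: "\<And>k::nat. 0 < \<epsilon> k" "\<epsilon> \<longlonglongrightarrow> 0"
  shows "(\<lambda>k. LBINT s:{0..t}. (F (clip T (s + \<epsilon> k)) (x (clip T (s + \<epsilon> k))) -
      F s (x (clip T (s + \<epsilon> k)))) / \<epsilon> k) \<longlonglongrightarrow> (LBINT s:{0..t}. F\<^sub>t s (x s))"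
proof -
  let ?u = "\<lambda>k s. clip T (s + \<epsilon> k)"
  let ?h = "\<lambda>k s. (F (?u k s) (x (?u k s)) - F s (x (?u k s))) / \<epsilon> k"
  have y: "continuous_on A (\<lambda>z. x (clip T (f z)))" if "continuous_on A f" for f :: "real \<Rightarrow> real" and A
    by (rule continuous_on_compose2[OF x]) (use T that in \<open>auto intro!: continuous_intros\<close>)
  have ch: "continuous_on {0..t} (?h k)" for k
    using \<epsilon>(1)[of k] T t
    by (intro continuous_intros continuous_on_time_space[OF F] y) auto
  have cFt: "continuous_on {0..t} (\<lambda>s. F\<^sub>t s (x s))"
    using t by (intro continuous_on_time_space[OF Ft] continuous_intros continuous_on_subset[OF x]) auto
  have mv: "\<exists>r\<in>{s..?u k s}. ?h k s = F\<^sub>t r (x (?u k s)) * ((?u k s - s) / \<epsilon> k)" if s: "s \<in> {0..t}" for k s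
  proof -
    have "\<exists>r\<in>{s..?u k s}. F (?u k s) (x (?u k s)) - F s (x (?u k s)) = (?u k s - s) * F\<^sub>t r (x (?u k s))"
    proof (rule mvt_very_simple)
      show "s \<le> ?u k s" using s t \<epsilon>(1)[of k] by auto
      fix r assume r: "s \<le> r" "r \<le> ?u k s"
      have rT: "r \<in> {0..T}" "{s..?u k s} \<subseteq> {0..T}" using r s t T by auto
      show "((\<lambda>\<tau>. F \<tau> (x (?u k s))) has_derivative (\<lambda>h. h * F\<^sub>t r (x (?u k s)))) (at r within {s..?u k s})"
        using has_derivative_subset[OF D[OF rT(1), of "x (?u k s)"] rT(2)] .
    qed
    then show ?thesis by (auto simp: field_simps)
  qed
  have "compact ((\<lambda>z. F\<^sub>t (fst z) (x (snd z))) ` ({0..T} \<times> {0..T}))"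
    using T by (intro compact_continuous_image continuous_on_time_space[OF Ft]
        continuous_on_compose2[OF x] compact_Times continuous_intros) auto
  then obtain B where B: "\<And>r u. r \<in> {0..T} \<Longrightarrow> u \<in> {0..T} \<Longrightarrow> \<bar>F\<^sub>t r (x u)\<bar> \<le> B"
    by (force dest!: compact_imp_bounded simp: bounded_iff)
  have bound: "\<bar>?h k s\<bar> \<le> B" if s: "s \<in> {0..t}" for k s
  proof -
    from mv[OF s, of k] obtain r where r: "r \<in> {s..?u k s}" "?h k s = F\<^sub>t r (x (?u k s)) * ((?u k s - s) / \<epsilon> k)"
      by blast
    have "0 \<le> ?u k s" "?u k s \<le> T" using T by simp_all
    then have *: "\<bar>F\<^sub>t r (x (?u k s))\<bar> \<le> B"
      using r(1) s by (intro B) (simp_all only: atLeastAtMost_iff, linarith+)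
    have "\<bar>(?u k s - s) / \<epsilon> k\<bar> \<le> 1" using \<epsilon>(1)[of k] s t by (auto simp: divide_simps abs_if)
    then have "\<bar>F\<^sub>t r (x (?u k s))\<bar> * \<bar>(?u k s - s) / \<epsilon> k\<bar> \<le> B * 1"
      using * by (intro mult_mono) auto
    then show ?thesis by (simp add: r(2) abs_mult)
  qed
  have conv: "(\<lambda>k. ?h k s) \<longlonglongrightarrow> F\<^sub>t s (x s)" if s: "s \<in> {0..t}" "s < T" for s
  proof -
    have "\<exists>r. \<forall>k. r k \<in> {s..?u k s} \<and> ?h k s = F\<^sub>t (r k) (x (?u k s)) * ((?u k s - s) / \<epsilon> k)"
      using mv[OF s(1)] by (intro choice) blast
    then obtain r where r: "\<And>k. r k \<in> {s..?u k s}" "\<And>k. ?h k s = F\<^sub>t (r k) (x (?u k s)) * ((?u k s - s) / \<epsilon> k)"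
      by blast
    have u: "(\<lambda>k. ?u k s) \<longlonglongrightarrow> s"
    proof -
      have "(\<lambda>k. ?u k s) \<longlonglongrightarrow> clip T (s + 0)" by (intro tendsto_intros \<epsilon>)
      then show ?thesis using s by simp
    qed
    have rl: "r \<longlonglongrightarrow> s"
      by (rule tendsto_sandwich[OF _ _ tendsto_const u]) (use r(1) in auto)
    have xl: "(\<lambda>k. x (?u k s)) \<longlonglongrightarrow> x s"
      by (rule continuous_on_tendsto_compose[OF x u]) (use s t T in auto)
    have rT: "0 \<le> r k \<and> r k \<le> T" for k
    proof -
      have "?u k s \<le> T" using T by simp
      with r(1)[of k] s(1) show ?thesis by (simp only: atLeastAtMost_iff) linarith
    qed
    have "(\<lambda>k. (\<lambda>(s, \<eta>). F\<^sub>t s \<eta>) (r k, x (?u k s))) \<longlonglongrightarrow> (\<lambda>(s, \<eta>). F\<^sub>t s \<eta>) (s, x s)"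
      by (rule continuous_on_tendsto_compose[OF Ft tendsto_Pair[OF rl xl]])
        (use s rT in auto)
    then have lim: "(\<lambda>k. F\<^sub>t (r k) (x (?u k s))) \<longlonglongrightarrow> F\<^sub>t s (x s)" by simp
    have "\<forall>\<^sub>F k in sequentially. \<epsilon> k < T - s" using \<epsilon>(2) s by (intro order_tendstoD(2)) auto
    then have "\<forall>\<^sub>F k in sequentially. F\<^sub>t (r k) (x (?u k s)) = ?h k s"
    proof eventually_elim
      case (elim k)
      then have "?u k s - s = \<epsilon> k" using s \<epsilon>(1)[of k] by auto
      then show ?case using r(2)[of k] \<epsilon>(1)[of k] by simp
    qed
    then show ?thesis by (rule Lim_transform_eventually[OF lim])
  qed
  show ?thesis unfolding set_lebesgue_integral_def
  proof (rule integral_dominated_convergence)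
    show "integrable lborel (\<lambda>s. indicator {0..t} s *\<^sub>R B)"
      using borel_integrable_atLeastAtMost'[of 0 t "\<lambda>_. B"] by (simp add: set_integrable_def)
    \<comment> \<open>At \<open>s = T\<close> the cut-off makes all quotients vanish, whereas the limit may not.\<close>
    have "AE s in lborel. s \<noteq> T" by (rule AE_lborel_singleton)
    then show "AE s in lborel. (\<lambda>k. indicator {0..t} s *\<^sub>R ?h k s) \<longlonglongrightarrow> indicator {0..t} s *\<^sub>R F\<^sub>t s (x s)"
    proof eventually_elim
      case (elim s)
      show ?case
      proof (cases "s \<in> {0..t}")
        case True
        then show ?thesis using conv[of s] elim t by simp
      qed simp
    qed
    show "AE s in lborel. norm (indicator {0..t} s *\<^sub>R ?h k s) \<le> indicator {0..t} s *\<^sub>R B" for k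
      using bound[of _ k] by (intro AE_I2) (simp add: indicator_def del: max_less_iff_conj)
    show "(\<lambda>s. indicator {0..t} s *\<^sub>R F\<^sub>t s (x s)) \<in> borel_measurable lborel"
      using borel_measurable_continuous_on_indicator[OF _ cFt] by simp
    show "(\<lambda>s. indicator {0..t} s *\<^sub>R ?h k s) \<in> borel_measurable lborel" for k
      using borel_measurable_continuous_on_indicator[OF _ ch[of k]] by simp
  qed
qed

text \<open>The deterministic form of the theorem. The weighted squared increments of the path have bounded mass
  \<open>K\<close> in the dual of the Chi-subspace, as (H1) provides, and \<open>S\<close> is the limit of the second-order terms.
  In the proof, \<open>r k s\<close> is the Taylor remainder divided by \<open>\<epsilon> k\<close>.\<close>

lemma pathwise_ito:
  fixes x :: "real \<Rightarrow> 'b::banach" and \<iota> :: "'c::banach \<Rightarrow>\<^sub>L 'b \<Rightarrow>\<^sub>L 'b \<Rightarrow>\<^sub>L real"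
    and \<epsilon> :: "nat \<Rightarrow> real" and T :: real
  defines "\<Delta> \<equiv> \<lambda>k s. x (clip T (s + \<epsilon> k)) - x (clip T s)"
  assumes T: "0 < T" and t: "t \<in> {0..T}" and x: "continuous_on {0..T} x"
    and C12: "frechet_C12 T F F\<^sub>t DF D2F"
    and G: "\<And>t \<eta>. t \<in> {0..T} \<Longrightarrow> \<iota> (G t \<eta>) = D2F t \<eta>"
      "continuous_on ({0..T} \<times> UNIV) (\<lambda>(t, \<eta>). G t \<eta>)"
    and \<epsilon>: "\<And>k. 0 < \<epsilon> k" "\<epsilon> \<longlonglongrightarrow> 0"
    and K: "\<And>k. (\<integral>\<^sup>+s\<in>{0..t}. ennreal (norm (inverse (\<epsilon> k) *\<^sub>R chi_tensor \<iota> (\<Delta> k s) (\<Delta> k s))) \<partial>lborel) \<le> ennreal K" "0 \<le> K"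
    and S: "(\<lambda>k. LBINT s:{0..t}. (inverse (\<epsilon> k) *\<^sub>R chi_tensor \<iota> (\<Delta> k s) (\<Delta> k s)) (G s (x s))) \<longlonglongrightarrow> S"
  shows "(\<lambda>k. LBINT s:{0..t}. DF s (x s) (inverse (\<epsilon> k) *\<^sub>R \<Delta> k s)) \<longlonglongrightarrow>
    F t (x t) - F 0 (x 0) - (LBINT s:{0..t}. F\<^sub>t s (x s)) - 1 / 2 * S"
proof -
  note D = frechet_C12_D[OF C12]
  define f where "f s = F (clip T s) (x (clip T s))" for s
  define m where "m k s = inverse (\<epsilon> k) *\<^sub>R chi_tensor \<iota> (\<Delta> k s) (\<Delta> k s)" for k s
  define a where "a k s = DF s (x s) (inverse (\<epsilon> k) *\<^sub>R \<Delta> k s)" for k s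
  define h where "h k s = (F (clip T (s + \<epsilon> k)) (x (clip T (s + \<epsilon> k))) -
      F s (x (clip T (s + \<epsilon> k)))) / \<epsilon> k" for k s
  define r where "r k s = (f (s + \<epsilon> k) - f s) / \<epsilon> k - h k s - a k s - 1 / 2 * m k s (G s (x s))" for k s
  have y: "continuous_on A (\<lambda>z. x (clip T (g z)))" if "continuous_on A g" for g :: "real \<Rightarrow> real" and A
    by (rule continuous_on_compose2[OF x]) (use T that in \<open>auto intro!: continuous_intros\<close>)
  have cf: "continuous_on UNIV f" unfolding f_def
    using T by (intro continuous_on_time_space[OF D(4)] y continuous_intros) auto
  have cx: "continuous_on {0..t} x" by (rule continuous_on_subset[OF x]) (use t in auto)
  have c\<Delta>: "continuous_on {0..t} (\<Delta> k)" for k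
    unfolding \<Delta>_def by (intro continuous_intros y)
  have cm: "continuous_on {0..t} (m k)" for k
    unfolding m_def by (intro continuous_intros continuous_on_chi_tensor c\<Delta>)
  have clipped: "continuous_on {0..t} (\<lambda>s. H s (g s))"
    if "continuous_on ({0..T} \<times> UNIV) (\<lambda>(s, \<eta>). H s \<eta>)" "continuous_on {0..t} g"
    for H :: "real \<Rightarrow> 'b \<Rightarrow> 'z::topological_space" and g
    by (intro continuous_on_time_space[OF that(1)] continuous_intros that) (use t in auto)
  have ca: "continuous_on {0..t} (a k)" for k
    unfolding a_def by (intro continuous_intros clipped[OF D(6)] c\<Delta> cx)
  have ch: "continuous_on {0..t} (h k)" for k
    unfolding h_def using \<epsilon>(1)[of k] T
    by (intro continuous_intros clipped[OF D(4)] y continuous_on_time_space[OF D(4)]) auto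
  have cq: "continuous_on {0..t} (\<lambda>s. (f (s + \<epsilon> k) - f s) / \<epsilon> k)" for k
    using \<epsilon>(1)[of k]
    by (intro continuous_intros continuous_on_compose2[OF cf] continuous_on_subset[OF cf]) auto
  have cmG: "continuous_on {0..t} (\<lambda>s. m k s (G s (x s)))" for k
    by (intro continuous_intros cm clipped[OF G(2)] cx)
  have cr: "continuous_on {0..t} (r k)" for k
    unfolding r_def by (intro continuous_intros cq ch ca cmG)
  note int = borel_integrable_atLeastAtMost'[OF cr] borel_integrable_atLeastAtMost'[OF cq]
    borel_integrable_atLeastAtMost'[OF ch] borel_integrable_atLeastAtMost'[OF ca]
    borel_integrable_atLeastAtMost'[OF cmG]
  have r_le: "\<bar>r k s\<bar> \<le> e * norm (m k s)"
    if s: "s \<in> {0..t}" and e: "\<And>b. b \<in> {0..1} \<Longrightarrow> norm (G s (x s + b *\<^sub>R \<Delta> k s) - G s (x s)) \<le> 2 * e" for k s e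
  proof -
    have sT: "s \<in> {0..T}" and cs: "clip T s = s" using s t by auto
    from second_order_taylor[OF D(1,3), OF sT sT, of "x s" "\<Delta> k s"] obtain b where b: "b \<in> {0..1}"
      "F s (x s + \<Delta> k s) - F s (x s) = DF s (x s) (\<Delta> k s) + 1 / 2 * D2F s (x s + b *\<^sub>R \<Delta> k s) (\<Delta> k s) (\<Delta> k s)"
      by blast
    have "f (s + \<epsilon> k) - f s - h k s * \<epsilon> k = F s (x s + \<Delta> k s) - F s (x s)"
      using \<epsilon>(1)[of k] by (simp add: f_def h_def \<Delta>_def cs)
    moreover have "D2F s (x s + b *\<^sub>R \<Delta> k s) (\<Delta> k s) (\<Delta> k s) = \<epsilon> k * m k s (G s (x s + b *\<^sub>R \<Delta> k s))"
      using \<epsilon>(1)[of k] by (simp add: m_def chi_tensor_apply G(1)[OF sT] blinfun.scaleR_left)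
    ultimately have "r k s = 1 / 2 * m k s (G s (x s + b *\<^sub>R \<Delta> k s) - G s (x s))"
      using \<epsilon>(1)[of k] b(2) unfolding r_def a_def
      by (simp add: field_simps blinfun.scaleR_right blinfun.diff_right)
    then have "\<bar>r k s\<bar> \<le> 1 / 2 * (norm (m k s) * norm (G s (x s + b *\<^sub>R \<Delta> k s) - G s (x s)))"
      using norm_blinfun[of "m k s" "G s (x s + b *\<^sub>R \<Delta> k s) - G s (x s)"] by simp
    also have "\<dots> \<le> 1 / 2 * (norm (m k s) * (2 * e))" by (intro mult_left_mono e b) auto
    finally show ?thesis by (simp add: mult.commute)
  qed
  have R: "(\<lambda>k. LBINT s:{0..t}. r k s) \<longlonglongrightarrow> 0"
  proof (rule LIMSEQ_I)
    fix e :: real assume "0 < e"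
    \<comment> \<open>The \<open>1\<close> covers the case \<open>K = 0\<close>.\<close>
    define e' where "e' = e / (2 * (K + 1))"
    have e': "0 < e'" "e' * K < e" using \<open>0 < e\<close> K(2) mult_nonneg_nonneg[of K e]
      by (auto simp: e'_def field_simps intro: add_nonneg_pos)
    obtain d where d: "0 < d" "\<And>s u b. s\<in>{0..T} \<Longrightarrow> u\<in>{0..T} \<Longrightarrow> b\<in>{0..1} \<Longrightarrow> \<bar>u - s\<bar> < d \<Longrightarrow>
        norm (G s (x s + b *\<^sub>R (x u - x s)) - G s (x s)) < 2 * e'"
      using uniform_modulus_along_path[OF _ G(2) x, of "2 * e'"] T e' by auto
    have "\<forall>\<^sub>F k in sequentially. \<epsilon> k < d" using \<epsilon>(2) d(1) by (intro order_tendstoD(2)) auto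
    then have "\<forall>\<^sub>F k in sequentially. norm ((LBINT s:{0..t}. r k s) - 0) < e"
    proof eventually_elim
      case (elim k)
      have "\<bar>LBINT s:{0..t}. r k s\<bar> \<le> e' * K"
      proof (rule abs_set_integral_le_density[OF int(1) _ _ K(2)])
        show "continuous_on {0..t} (\<lambda>s. norm (m k s))" by (intro continuous_intros cm)
        show "(\<integral>\<^sup>+s\<in>{0..t}. ennreal (norm (m k s)) \<partial>lborel) \<le> ennreal K"
          using K(1)[of k] by (simp add: m_def)
        fix s assume s: "s \<in> {0<..t}"
        show "\<bar>r k s\<bar> \<le> e' * norm (m k s)"
        proof (rule r_le)
          fix b :: real assume b: "b \<in> {0..1}"
          have "\<Delta> k s = x (clip T (s + \<epsilon> k)) - x s" using s t by (simp add: \<Delta>_def)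
          moreover have "\<bar>clip T (s + \<epsilon> k) - s\<bar> < d" "clip T (s + \<epsilon> k) \<in> {0..T}"
            using s t elim \<epsilon>(1)[of k] by (auto simp: abs_if)
          ultimately show "norm (G s (x s + b *\<^sub>R \<Delta> k s) - G s (x s)) \<le> 2 * e'"
            using d(2)[of s "clip T (s + \<epsilon> k)" b] s t b by simp
        qed (use s in auto)
      qed (use e' in auto)
      then show ?case using e' by simp
    qed
    then show "\<exists>no. \<forall>n\<ge>no. norm ((LBINT s:{0..t}. r n s) - 0) < e"
      by (simp add: eventually_sequentially)
  qed
  have eq: "(LBINT s:{0..t}. (f (s + \<epsilon> k) - f s) / \<epsilon> k) - (LBINT s:{0..t}. h k s)
      - 1 / 2 * (LBINT s:{0..t}. m k s (G s (x s))) - (LBINT s:{0..t}. r k s) = (LBINT s:{0..t}. a k s)" for k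
  proof -
    note d1 = set_integral_diff[OF int(2)[of k] int(3)[of k]]
    note d2 = set_integral_diff[OF d1(1) set_integrable_mult_right[of "1 / 2", OF int(5)[of k]]]
    note d3 = set_integral_diff[OF d2(1) int(1)[of k]]
    have "(LBINT s:{0..t}. a k s) = (LBINT s:{0..t}. (f (s + \<epsilon> k) - f s) / \<epsilon> k - h k s
        - 1 / 2 * m k s (G s (x s)) - r k s)"
      by (simp add: r_def)
    also have "\<dots> = (LBINT s:{0..t}. (f (s + \<epsilon> k) - f s) / \<epsilon> k) - (LBINT s:{0..t}. h k s)
        - (LBINT s:{0..t}. 1 / 2 * m k s (G s (x s))) - (LBINT s:{0..t}. r k s)"
      unfolding d3(2) d2(2) d1(2) ..
    finally show ?thesis by simp
  qed
  have 1: "(\<lambda>k. LBINT s:{0..t}. (f (s + \<epsilon> k) - f s) / \<epsilon> k) \<longlonglongrightarrow> f t - f 0"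
    by (rule integral_difference_quotient_tendsto[OF cf _ \<epsilon>]) (use t in auto)
  have 2: "(\<lambda>k. LBINT s:{0..t}. h k s) \<longlonglongrightarrow> (LBINT s:{0..t}. F\<^sub>t s (x s))"
    unfolding h_def by (rule time_increments_tendsto[OF T t x D(4,5,2) \<epsilon>])
  have f: "f t = F t (x t)" "f 0 = F 0 (x 0)" using t T by (auto simp: f_def)
  have "(\<lambda>k. (LBINT s:{0..t}. (f (s + \<epsilon> k) - f s) / \<epsilon> k) - (LBINT s:{0..t}. h k s)
      - 1 / 2 * (LBINT s:{0..t}. m k s (G s (x s))) - (LBINT s:{0..t}. r k s)) \<longlonglongrightarrow>
      f t - f 0 - (LBINT s:{0..t}. F\<^sub>t s (x s)) - 1 / 2 * S - 0"
    by (intro tendsto_diff tendsto_mult tendsto_const 1 2 R S[folded m_def])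
  then show ?thesis unfolding eq f a_def by simp
qed

section \<open>Convergence in probability and almost sure subsequences\<close>

lemma (in complete_measure) borel_measurable_AE_cong:
  fixes f g :: "'a \<Rightarrow> 'z::topological_space"
  assumes f: "f \<in> borel_measurable M" and eq: "AE x in M. f x = g x"
  shows "g \<in> borel_measurable M"
proof (rule measurableI)
  fix A :: "'z set" assume "A \<in> sets borel"
  then have "f -` A \<inter> space M \<in> sets M" using f by (rule measurable_sets[rotated])
  then show "g -` A \<inter> space M \<in> sets M"
    by (rule in_sets_AE[rotated]) (use eq in \<open>auto elim!: eventually_mono\<close>)
qed simp

lemma (in prob_space) AE_tendsto_imp_measure_tendsto_0:
  fixes Z :: "nat \<Rightarrow> 'a \<Rightarrow> real"
  assumes [measurable]: "\<And>k. Z k \<in> borel_measurable M" "L \<in> borel_measurable M"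
    and AE: "AE \<omega> in M. (\<lambda>k. Z k \<omega>) \<longlonglongrightarrow> L \<omega>" and \<delta>: "0 < \<delta>"
  shows "(\<lambda>k. measure M {\<omega>\<in>space M. \<delta> < \<bar>Z k \<omega> - L \<omega>\<bar>}) \<longlonglongrightarrow> 0"
proof -
  let ?A = "\<lambda>k. {\<omega>\<in>space M. \<delta> < \<bar>Z k \<omega> - L \<omega>\<bar>}"
  have "(\<lambda>k. \<integral>\<omega>. indicat_real (?A k) \<omega> \<partial>M) \<longlonglongrightarrow> (\<integral>\<omega>. 0 \<partial>M)"
  proof (rule integral_dominated_convergence[where w="\<lambda>_. 1"])
    show "AE \<omega> in M. (\<lambda>k. indicat_real (?A k) \<omega>) \<longlonglongrightarrow> 0"
      using AE
    proof eventually_elim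
      case (elim \<omega>)
      have "\<forall>\<^sub>F k in sequentially. \<bar>Z k \<omega> - L \<omega>\<bar> < \<delta>"
        using tendstoD[OF elim \<delta>] by (simp add: dist_real_def)
      then have "\<forall>\<^sub>F k in sequentially. 0 = indicat_real (?A k) \<omega>"
        by eventually_elim (auto simp: indicator_def)
      then show ?case by (rule Lim_transform_eventually[OF tendsto_const])
    qed
  qed (auto simp: indicator_def)
  then show ?thesis by simp
qed

text \<open>If convergence failed, the exceptional probabilities would stay above some \<open>e > 0\<close> along a sequence
  decreasing to zero, and no subsequence of it could converge almost surely.\<close>

lemma (in prob_space) converges_in_probability_at_right_0I:
  fixes Z :: "real \<Rightarrow> 'a \<Rightarrow> real"
  assumes Z: "\<And>\<epsilon>. 0 < \<epsilon> \<Longrightarrow> Z \<epsilon> \<in> borel_measurable M" and L: "L \<in> borel_measurable M"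
    and sub: "\<And>\<epsilon>::nat \<Rightarrow> real. (\<And>n. 0 < \<epsilon> n) \<Longrightarrow> decseq \<epsilon> \<Longrightarrow> \<epsilon> \<longlonglongrightarrow> 0 \<Longrightarrow>
      \<exists>r. strict_mono r \<and> (AE \<omega> in M. (\<lambda>k. Z (\<epsilon> (r k)) \<omega>) \<longlonglongrightarrow> L \<omega>)"
  shows "converges_in_probability M Z L (at_right 0)"
  unfolding converges_in_probability_def
proof (intro conjI allI impI L)
  show "\<forall>\<^sub>F i in at_right 0. Z i \<in> borel_measurable M"
    using Z eventually_at_right_less[of "0::real"] by (auto elim: eventually_mono)
  fix \<delta> :: real assume \<delta>: "0 < \<delta>"
  let ?a = "\<lambda>\<epsilon>. measure M {\<omega>\<in>space M. \<delta> < \<bar>Z \<epsilon> \<omega> - L \<omega>\<bar>}"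
  show "(?a \<longlongrightarrow> 0) (at_right 0)"
  proof (rule tendsto_at_right_sequentially[of 0 1])
    fix \<epsilon> :: "nat \<Rightarrow> real" assume \<epsilon>: "\<And>n. 0 < \<epsilon> n" "decseq \<epsilon>" "\<epsilon> \<longlonglongrightarrow> 0"
    show "(\<lambda>n. ?a (\<epsilon> n)) \<longlonglongrightarrow> 0"
    proof (rule ccontr)
      assume "\<not> ?thesis"
      then obtain e where e: "0 < e" "\<not> (\<forall>\<^sub>F n in sequentially. dist (?a (\<epsilon> n)) 0 < e)"
        unfolding tendsto_iff by blast
      then obtain q :: "nat \<Rightarrow> nat" where q: "strict_mono q" "\<And>n. \<not> dist (?a (\<epsilon> (q n))) 0 < e"
        using not_eventually_sequentiallyD[OF e(2)] by blast
      obtain r where r: "strict_mono r" "AE \<omega> in M. (\<lambda>k. Z (\<epsilon> (q (r k))) \<omega>) \<longlonglongrightarrow> L \<omega>"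
        using sub[of "\<lambda>n. \<epsilon> (q n)"] \<epsilon> q(1) LIMSEQ_subseq_LIMSEQ[OF \<epsilon>(3) q(1)]
        by (auto simp: o_def decseq_def strict_mono_less_eq)
      have "(\<lambda>k. ?a (\<epsilon> (q (r k)))) \<longlonglongrightarrow> 0"
        by (rule AE_tendsto_imp_measure_tendsto_0[OF Z[OF \<epsilon>(1)] L r(2) \<delta>])
      from eventually_happens[OF tendstoD[OF this e(1)]] q(2) show False by auto
    qed
  qed simp
qed

text \<open>One subsequence for countably many sequences: choose \<open>r k\<close> so large that each of those numbered up to
  \<open>k\<close> exceeds \<open>2\<^sup>-\<^sup>k\<close> with probability less than \<open>2\<^sup>-\<^sup>k\<close>, and apply the Borel--Cantelli lemma to each.\<close>

lemma (in prob_space) common_AE_subsequence: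
  fixes W :: "'i \<Rightarrow> nat \<Rightarrow> 'a \<Rightarrow> real"
  assumes J: "countable J"
    and meas: "\<And>j. j \<in> J \<Longrightarrow> \<forall>\<^sub>F n in sequentially. W j n \<in> borel_measurable M"
    and lim: "\<And>j \<delta>. j \<in> J \<Longrightarrow> 0 < \<delta> \<Longrightarrow> (\<lambda>n. measure M {\<omega>\<in>space M. \<delta> < \<bar>W j n \<omega>\<bar>}) \<longlonglongrightarrow> 0"
  shows "\<exists>r::nat \<Rightarrow> nat. strict_mono r \<and> (AE \<omega> in M. \<forall>j\<in>J. (\<lambda>k. W j (r k) \<omega>) \<longlonglongrightarrow> 0)"
proof (cases "J = {}")
  case True
  then show ?thesis by (auto intro: exI[of _ id] strict_mono_id)
next
  case False
  define f where "f = from_nat_into J"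
  have f: "f i \<in> J" for i unfolding f_def using False by (rule from_nat_into)
  let ?h = "\<lambda>k::nat. (1 / 2) ^ k :: real"
  let ?A = "\<lambda>i k n. {\<omega>\<in>space M. ?h k < \<bar>W (f i) n \<omega>\<bar>}"
  define P where "P k n \<longleftrightarrow> (\<forall>i\<in>{..k}. W (f i) n \<in> borel_measurable M \<and> measure M (?A i k n) < ?h k)" for k n
  have ev: "\<forall>\<^sub>F n in sequentially. P k n" for k
    unfolding P_def
  proof (rule eventually_ball_finite, simp, intro ballI)
    fix i assume "i \<in> {..k}"
    show "\<forall>\<^sub>F n in sequentially. W (f i) n \<in> borel_measurable M \<and> measure M (?A i k n) < ?h k"
      using meas[OF f] order_tendstoD(2)[OF lim[OF f, of "?h k" i], of "?h k"]
      by (auto intro: eventually_conj)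
  qed
  have "\<exists>r. \<forall>k. P k (r k) \<and> r k < r (Suc k)"
  proof (rule dependent_nat_choice[where Q="\<lambda>_. (<)"])
    show "\<exists>n. P 0 n" using ev[of 0] by (auto simp: eventually_sequentially)
    fix n k
    have "\<forall>\<^sub>F m in sequentially. P (Suc k) m \<and> n < m" using ev by (intro eventually_conj eventually_gt_at_top) auto
    then show "\<exists>m. P (Suc k) m \<and> n < m" by (auto simp: eventually_sequentially)
  qed
  then obtain r where r: "\<And>k. P k (r k)" "strict_mono r" by (auto simp: strict_mono_Suc_iff)
  have "AE \<omega> in M. (\<lambda>k. W (f i) (r k) \<omega>) \<longlonglongrightarrow> 0" for i
  proof -
    define B where "B k = (if i \<le> k then ?A i k (r k) else {})" for k
    have B[measurable]: "B k \<in> sets M" for k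
    proof (cases "i \<le> k")
      case True
      then have [measurable]: "W (f i) (r k) \<in> borel_measurable M" using r(1)[of k] by (auto simp: P_def)
      show ?thesis unfolding B_def by auto
    qed (simp add: B_def)
    have "summable (\<lambda>k. measure M (B k))"
    proof (rule summable_comparison_test'[where N=0])
      show "summable (\<lambda>k. ?h k)" by (rule summable_geometric) simp
      show "norm (measure M (B k)) \<le> ?h k" for k
        using r(1)[of k] by (auto simp: B_def P_def intro: less_imp_le)
    qed
    then have "AE \<omega> in M. \<forall>\<^sub>F k in sequentially. \<omega> \<in> space M - B k"
      by (intro borel_cantelli_AE1) (auto simp: emeasure_eq_measure)
    then show ?thesis
    proof eventually_elim
      case (elim \<omega>)
      then have "\<forall>\<^sub>F k in sequentially. norm (W (f i) (r k) \<omega>) \<le> ?h k"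
        using eventually_ge_at_top[of i] by eventually_elim (auto simp: B_def)
      moreover have "?h \<longlonglongrightarrow> 0" by (rule LIMSEQ_power_zero) simp
      ultimately show ?case by (rule Lim_null_comparison)
    qed
  qed
  then have "AE \<omega> in M. \<forall>i. (\<lambda>k. W (f i) (r k) \<omega>) \<longlonglongrightarrow> 0" by (simp add: AE_all_countable)
  then have "AE \<omega> in M. \<forall>j\<in>J. (\<lambda>k. W j (r k) \<omega>) \<longlonglongrightarrow> 0"
    by eventually_elim (metis f_def from_nat_into_surj J)
  with r(2) show ?thesis by blast
qed

text \<open>The supremum over \<open>[0, T]\<close> dominates the value at \<open>t\<close>. What has to be proved is that the event in which
  the supremum exceeds \<open>\<delta>\<close> is measurable, as \<open>measure\<close> is zero on other sets:
  by continuity of the paths it agrees almost surely with an event that involves countably many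
  times only.\<close>

lemma (in prob_space) converges_ucp_imp_pointwise:
  fixes Z :: "'i \<Rightarrow> real \<Rightarrow> 'a \<Rightarrow> real"
  assumes complete: "complete_measure M" and ucp: "converges_ucp M T Z L G" and t: "t \<in> {0..T}"
  shows "converges_in_probability M (\<lambda>i. Z i t) (L t) G"
  unfolding converges_in_probability_def
proof (intro conjI allI impI)
  interpret complete_measure M by fact
  from ucp have L: "continuous_process M T L" and Z: "\<forall>\<^sub>F i in G. continuous_process M T (Z i)"
    unfolding converges_ucp_def by auto
  show "L t \<in> borel_measurable M" using L t by (simp add: continuous_process_def)
  show "\<forall>\<^sub>F i in G. Z i t \<in> borel_measurable M"
    using Z by eventually_elim (use t in \<open>simp add: continuous_process_def\<close>)
  fix \<delta> :: real assume \<delta>: "0 < \<delta>"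
  let ?S = "\<lambda>i. {\<omega>\<in>space M. ennreal \<delta> < (SUP t\<in>{0..T}. ennreal \<bar>Z i t \<omega> - L t \<omega>\<bar>)}"
  have sets: "?S i \<in> sets M" if Zi: "continuous_process M T (Z i)" for i
  proof -
    obtain D :: "real set" where D: "countable D" "D \<subseteq> {0..T}" "{0..T} \<subseteq> closure D"
      using separable by blast
    let ?A = "{\<omega>\<in>space M. \<exists>s\<in>D. \<delta> < \<bar>Z i s \<omega> - L s \<omega>\<bar>}"
    have "(\<Union>s\<in>D. {\<omega>\<in>space M. \<delta> < \<bar>Z i s \<omega> - L s \<omega>\<bar>}) \<in> sets M"
    proof (rule sets.countable_UN'[OF D(1)], rule image_subsetI)
      fix s assume "s \<in> D"
      then have [measurable]: "Z i s \<in> borel_measurable M" "L s \<in> borel_measurable M"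
        using D(2) Zi L by (auto simp: continuous_process_def)
      show "{\<omega>\<in>space M. \<delta> < \<bar>Z i s \<omega> - L s \<omega>\<bar>} \<in> sets M" by measurable
    qed
    also have "(\<Union>s\<in>D. {\<omega>\<in>space M. \<delta> < \<bar>Z i s \<omega> - L s \<omega>\<bar>}) = ?A" by auto
    finally have A: "?A \<in> sets M" .
    have "AE \<omega> in M. \<omega> \<in> ?A \<longleftrightarrow> \<omega> \<in> ?S i"
    proof -
      have "AE \<omega> in M. continuous_on {0..T} (\<lambda>s. Z i s \<omega>)" "AE \<omega> in M. continuous_on {0..T} (\<lambda>s. L s \<omega>)"
        using Zi L by (auto simp: continuous_process_def)
      then show ?thesis
      proof eventually_elim
        case (elim \<omega>)
        have c: "continuous_on {0..T} (\<lambda>s. \<bar>Z i s \<omega> - L s \<omega>\<bar>)" using elim by (intro continuous_intros)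
        have "\<exists>s\<in>D. \<delta> < \<bar>Z i s \<omega> - L s \<omega>\<bar>" if u: "u \<in> {0..T}" "\<delta> < \<bar>Z i u \<omega> - L u \<omega>\<bar>" for u
        proof -
          from u(1) D(3) have "u \<in> closure D" by blast
          then obtain q where q: "\<And>n. q n \<in> D" "q \<longlonglongrightarrow> u" by (auto simp: closure_sequential)
          have "(\<lambda>n. \<bar>Z i (q n) \<omega> - L (q n) \<omega>\<bar>) \<longlonglongrightarrow> \<bar>Z i u \<omega> - L u \<omega>\<bar>"
            by (rule continuous_on_tendsto_compose[OF c q(2) u(1)])
              (use q(1) D(2) in \<open>intro always_eventually allI, blast\<close>)
          from order_tendstoD(1)[OF this u(2)] q(1) show ?thesis
            by (auto simp: eventually_sequentially)
        qed
        then show ?case using D(2) \<delta> by (auto simp: less_SUP_iff ennreal_less_iff)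
      qed
    qed
    then show ?thesis by (rule in_sets_AE[OF _ A]) auto
  qed
  show "((\<lambda>i. measure M {\<omega>\<in>space M. \<delta> < \<bar>Z i t \<omega> - L t \<omega>\<bar>}) \<longlongrightarrow> 0) G"
  proof (rule tendsto_sandwich[OF _ _ tendsto_const])
    show "((\<lambda>i. measure M (?S i)) \<longlongrightarrow> 0) G" using ucp \<delta> by (simp add: converges_ucp_def)
    show "\<forall>\<^sub>F i in G. measure M {\<omega>\<in>space M. \<delta> < \<bar>Z i t \<omega> - L t \<omega>\<bar>} \<le> measure M (?S i)"
      using Z
    proof eventually_elim
      case (elim i)
      show ?case
        by (intro finite_measure_mono sets elim) (use t \<delta> in \<open>auto simp: less_SUP_iff ennreal_less_iff intro!: bexI[of _ t]\<close>)
    qed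
  qed simp
qed

section \<open>Measurability along continuous processes\<close>

lemma complete_measure_of_usual_conditions:
  assumes "usual_conditions M T \<F>" "0 \<le> T"
  shows "complete_measure M"
proof
  fix A B assume "B \<subseteq> A" "A \<in> null_sets M"
  then have "B \<in> sets (\<F> 0)" using assms(1) unfolding usual_conditions_def by blast
  moreover have "subalgebra M (\<F> 0)" using assms by (auto simp: usual_conditions_def)
  ultimately show "B \<in> sets M" by (auto simp: subalgebra_def)
qed

text \<open>Approximate the time \<open>s\<close> by multiples of \<open>1 / (n + 1)\<close>; the approximations run through countably many
  times.\<close>

lemma borel_measurable_pair_of_continuous:
  fixes Y :: "real \<Rightarrow> 'a \<Rightarrow> 'b::metric_space"
  assumes meas: "\<And>s. Y s \<in> borel_measurable M"
    and cont: "\<And>\<omega>. \<omega> \<in> space M \<Longrightarrow> continuous_on UNIV (\<lambda>s. Y s \<omega>)"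
  shows "(\<lambda>(\<omega>, s). Y s \<omega>) \<in> borel_measurable (M \<Otimes>\<^sub>M borel)"
proof (rule borel_measurable_LIMSEQ_metric)
  let ?q = "\<lambda>n s. of_int \<lfloor>s * real (Suc n)\<rfloor> / real (Suc n)"
  show "(\<lambda>z. Y (?q n (snd z)) (fst z)) \<in> borel_measurable (M \<Otimes>\<^sub>M borel)" for n
    by (rule measurable_compose_countable[where f="\<lambda>i z. Y (of_int i / real (Suc n)) (fst z)"
          and g="\<lambda>z. \<lfloor>snd z * real (Suc n)\<rfloor>"])
      (auto intro: measurable_compose[OF measurable_fst meas])
  fix z assume z: "z \<in> space (M \<Otimes>\<^sub>M (borel :: real measure))"
  have q: "(\<lambda>n. ?q n s) \<longlonglongrightarrow> s" for s :: real
  proof (rule LIM_zero_cancel, rule Lim_null_comparison)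
    show "\<forall>\<^sub>F n in sequentially. norm (?q n s - s) \<le> 1 / real (Suc n)"
    proof (intro always_eventually allI)
      fix n
      have "?q n s - s = (of_int \<lfloor>s * real (Suc n)\<rfloor> - s * real (Suc n)) / real (Suc n)"
        by (simp add: diff_divide_distrib)
      moreover have "\<bar>of_int \<lfloor>s * real (Suc n)\<rfloor> - s * real (Suc n)\<bar> \<le> 1" by linarith
      ultimately show "norm (?q n s - s) \<le> 1 / real (Suc n)"
        by (simp add: divide_right_mono del: of_nat_Suc)
    qed
    show "(\<lambda>n. 1 / real (Suc n)) \<longlonglongrightarrow> 0" using LIMSEQ_inverse_real_of_nat by (simp add: inverse_eq_divide)
  qed
  show "(\<lambda>n. Y (?q n (snd z)) (fst z)) \<longlonglongrightarrow> (case z of (\<omega>, s) \<Rightarrow> Y s \<omega>)"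
    using continuous_on_tendsto_compose[OF cont q, of "fst z" "snd z"] z
    by (auto simp: space_pair_measure split: prod.split)
qed

text \<open>Redefining \<open>X\<close> as zero on the exceptional null set makes every path continuous, so that \<open>Y\<close> is
  jointly measurable.\<close>

lemma continuous_modification:
  fixes X :: "real \<Rightarrow> 'w \<Rightarrow> 'b::real_normed_vector"
  assumes T: "0 \<le> T" and X: "continuous_process M T X"
  obtains \<Omega>\<^sub>0 Y where "\<Omega>\<^sub>0 \<in> sets M" "AE \<omega> in M. \<omega> \<in> \<Omega>\<^sub>0"
    "\<And>s. Y s \<in> borel_measurable M" "\<And>\<omega>. continuous_on UNIV (\<lambda>s. Y s \<omega>)"
    "\<And>\<omega> s. \<omega> \<in> \<Omega>\<^sub>0 \<Longrightarrow> Y s \<omega> = extend_process T X s \<omega>"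
proof -
  from X have "AE \<omega> in M. continuous_on {0..T} (\<lambda>t. X t \<omega>)" by (simp add: continuous_process_def)
  then obtain N where N: "\<And>\<omega>. \<omega> \<in> space M - N \<Longrightarrow> continuous_on {0..T} (\<lambda>t. X t \<omega>)" "N \<in> null_sets M"
    using AE_E3 by blast
  define \<Omega>\<^sub>0 where "\<Omega>\<^sub>0 = space M - N"
  define Y where "Y s \<omega> = (if \<omega> \<in> \<Omega>\<^sub>0 then X (clip T s) \<omega> else 0)" for s \<omega>
  show thesis
  proof (rule that)
    show 1: "\<Omega>\<^sub>0 \<in> sets M" using N(2) by (auto simp: \<Omega>\<^sub>0_def)
    have "AE \<omega> in M. \<omega> \<notin> N" using N(2) by (rule AE_not_in)
    with AE_space show "AE \<omega> in M. \<omega> \<in> \<Omega>\<^sub>0" by eventually_elim (auto simp: \<Omega>\<^sub>0_def)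
    show "Y s \<in> borel_measurable M" for s
    proof -
      have [measurable]: "X (clip T s) \<in> borel_measurable M" using X T by (simp add: continuous_process_def)
      have [measurable]: "\<Omega>\<^sub>0 \<in> sets M" by fact
      show ?thesis unfolding Y_def by measurable
    qed
    show "continuous_on UNIV (\<lambda>s. Y s \<omega>)" for \<omega>
    proof (cases "\<omega> \<in> \<Omega>\<^sub>0")
      case True
      then have "continuous_on {0..T} (\<lambda>t. X t \<omega>)" using N(1) by (auto simp: \<Omega>\<^sub>0_def)
      then have "continuous_on UNIV (\<lambda>s. X (clip T s) \<omega>)"
        by (rule continuous_on_compose2) (use T in \<open>auto intro!: continuous_intros\<close>)
      then show ?thesis using True by (simp add: Y_def)
    qed (simp add: Y_def)
    show "\<And>\<omega> s. \<omega> \<in> \<Omega>\<^sub>0 \<Longrightarrow> Y s \<omega> = extend_process T X s \<omega>" by (simp add: Y_def extend_process_def)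
  qed
qed

text \<open>The target of \<open>G\<close> may be nonseparable, so the simple functions are constructed in the separable space
  \<open>real \<times> B\<close>, where they approximate \<open>(s, X\<^sub>s)\<close>, and are then composed with \<open>G\<close>.\<close>

lemma strongly_measurable_along_process:
  fixes X :: "real \<Rightarrow> 'w \<Rightarrow> 'b::{real_normed_vector, second_countable_topology}"
    and G :: "real \<Rightarrow> 'b \<Rightarrow> 'z::topological_space"
  assumes T: "0 \<le> T" and X: "continuous_process M T X"
    and G: "continuous_on ({0..T} \<times> UNIV) (\<lambda>(s, \<eta>). G s \<eta>)"
  shows "strongly_measurable_process M T (\<lambda>s \<omega>. G s (X s \<omega>))"
proof -
  obtain \<Omega>\<^sub>0 Y where \<Omega>\<^sub>0: "\<Omega>\<^sub>0 \<in> sets M" "AE \<omega> in M. \<omega> \<in> \<Omega>\<^sub>0"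
    and Y: "\<And>s. Y s \<in> borel_measurable M" "\<And>\<omega>. continuous_on UNIV (\<lambda>s. Y s \<omega>)"
    and XY: "\<And>\<omega> s. \<omega> \<in> \<Omega>\<^sub>0 \<Longrightarrow> Y s \<omega> = extend_process T X s \<omega>"
    using continuous_modification[OF T X] by blast
  let ?N = "restrict_space lborel {0..T}"
  have sndm: "snd \<in> measurable (M \<Otimes>\<^sub>M ?N) borel"
    by (rule measurable_compose[OF measurable_snd]) (simp add: measurable_restrict_space1)
  have "(\<lambda>z. (fst z, snd z)) \<in> measurable (M \<Otimes>\<^sub>M ?N) (M \<Otimes>\<^sub>M borel)"
    by (intro measurable_Pair measurable_fst sndm)
  from measurable_compose[OF this borel_measurable_pair_of_continuous[OF Y]]
  have Ym: "(\<lambda>z. Y (snd z) (fst z)) \<in> borel_measurable (M \<Otimes>\<^sub>M ?N)" by simp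
  have "(\<lambda>z. (snd z, Y (snd z) (fst z))) \<in> borel_measurable (M \<Otimes>\<^sub>M ?N)"
    using sndm Ym by (rule borel_measurable_Pair)
  from borel_measurable_implies_sequence_metric[OF this]
  obtain f where f: "\<And>i::nat. simple_function (M \<Otimes>\<^sub>M ?N) (f i)"
    "\<And>z. z \<in> space (M \<Otimes>\<^sub>M ?N) \<Longrightarrow> (\<lambda>i. f i z) \<longlonglongrightarrow> (snd z, Y (snd z) (fst z))"
    by blast
  let ?g = "\<lambda>p. G (clip T (fst p)) (snd p)"
  have cg: "continuous_on UNIV ?g"
    using T by (intro continuous_on_time_space[OF G] continuous_intros) auto
  show ?thesis unfolding strongly_measurable_process_def
  proof (intro exI[of _ "\<lambda>i z. ?g (f i z)"] conjI allI)
    show "simple_function (M \<Otimes>\<^sub>M ?N) (\<lambda>z. ?g (f i z))" for i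
      by (rule simple_function_compose1[OF f(1)])
    have "AE z in M \<Otimes>\<^sub>M ?N. fst z \<in> \<Omega>\<^sub>0"
    proof -
      interpret N: sigma_finite_measure ?N
        by (rule sigma_finite_measure_restrict_space[OF sigma_finite_lborel]) simp
      have "emeasure M (space M - \<Omega>\<^sub>0) = 0"
        using \<Omega>\<^sub>0 AE_iff_measurable[of "space M - \<Omega>\<^sub>0" M "\<lambda>\<omega>. \<omega> \<in> \<Omega>\<^sub>0"] by auto
      then have "emeasure (M \<Otimes>\<^sub>M ?N) ((space M - \<Omega>\<^sub>0) \<times> space ?N) = 0"
        using \<Omega>\<^sub>0(1) N.emeasure_pair_measure_Times[OF _ sets.top, of "space M - \<Omega>\<^sub>0" M] by auto
      then show ?thesis
        by (rule AE_I[OF _ _ pair_measureI[OF sets.compl_sets[OF \<Omega>\<^sub>0(1)] sets.top], rotated])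
          (auto simp: space_pair_measure)
    qed
    with AE_space show "AE z in M \<Otimes>\<^sub>M ?N. (\<lambda>i. ?g (f i z)) \<longlonglongrightarrow> G (snd z) (X (snd z) (fst z))"
    proof eventually_elim
      case (elim z)
      have "snd z \<in> {0..T}" using elim(1) by (auto simp: space_pair_measure)
      then have "clip T (snd z) = snd z" "Y (snd z) (fst z) = X (snd z) (fst z)"
        using XY[OF elim(2), of "snd z"] by (auto simp: extend_process_def)
      with continuous_on_tendsto_compose[OF cg f(2)[OF elim(1)]] show ?case by simp
    qed
  qed
qed

text \<open>The integrand is a continuous function of \<open>s\<close>, \<open>X\<^sub>s\<close> and \<open>X\<^sub>s\<^sub>+\<^sub>\<epsilon>\<close>, which take values in
  separable spaces; so it is jointly measurable after passage to the continuous modification, and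
  completeness of \<open>M\<close> leads back to \<open>X\<close>.\<close>

lemma forward_quotient_measurable:
  fixes X :: "real \<Rightarrow> 'w \<Rightarrow> 'b::{real_normed_vector, second_countable_topology}"
    and D :: "real \<Rightarrow> 'b \<Rightarrow> 'b \<Rightarrow>\<^sub>L real"
  assumes M: "complete_measure M" and T: "0 \<le> T" and t: "t \<in> {0..T}" and X: "continuous_process M T X"
    and D: "continuous_on ({0..T} \<times> UNIV) (\<lambda>(s, \<eta>). D s \<eta>)"
  shows "(\<lambda>\<omega>. LBINT s:{0..t}. D s (X s \<omega>) (a *\<^sub>R (extend_process T X (s + \<epsilon>) \<omega> - extend_process T X s \<omega>)))
    \<in> borel_measurable M"
proof -
  obtain \<Omega>\<^sub>0 Y where \<Omega>\<^sub>0: "\<Omega>\<^sub>0 \<in> sets M" "AE \<omega> in M. \<omega> \<in> \<Omega>\<^sub>0"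
    and Y: "\<And>s. Y s \<in> borel_measurable M" "\<And>\<omega>. continuous_on UNIV (\<lambda>s. Y s \<omega>)"
    and XY: "\<And>\<omega> s. \<omega> \<in> \<Omega>\<^sub>0 \<Longrightarrow> Y s \<omega> = extend_process T X s \<omega>"
    using continuous_modification[OF T X] by blast
  let ?g = "\<lambda>(s, x, y). D (clip T s) x (a *\<^sub>R (y - x))"
  have "continuous_on UNIV (\<lambda>p. D (clip T (fst p)) (fst (snd p)) (a *\<^sub>R (snd (snd p) - fst (snd p))))"
    using T by (intro continuous_on_time_space[OF D] continuous_intros) auto
  then have "continuous_on UNIV ?g" by (simp add: case_prod_beta)
  then have g: "?g \<in> borel_measurable borel" by (rule borel_measurable_continuous_onI)
  have "(\<lambda>(\<omega>, s). Y s \<omega>) \<in> borel_measurable (M \<Otimes>\<^sub>M borel)"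
    by (rule borel_measurable_pair_of_continuous[OF Y])
  moreover have "(\<lambda>z. (fst z, snd z + c)) \<in> measurable (M \<Otimes>\<^sub>M lborel) (M \<Otimes>\<^sub>M (borel :: real measure))" for c
    by measurable
  ultimately have Yc: "(\<lambda>z. Y (snd z + c) (fst z)) \<in> borel_measurable (M \<Otimes>\<^sub>M lborel)" for c
    using measurable_compose by fastforce
  have "(\<lambda>z. ?g (snd z, Y (snd z) (fst z), Y (snd z + \<epsilon>) (fst z))) \<in> borel_measurable (M \<Otimes>\<^sub>M lborel)"
  proof (rule measurable_compose[OF _ g], intro borel_measurable_Pair)
    show "(\<lambda>z. Y (snd z) (fst z)) \<in> borel_measurable (M \<Otimes>\<^sub>M lborel)" using Yc[of 0] by simp
  qed (use Yc in auto)
  then have [measurable]: "(\<lambda>(\<omega>, s). ?g (s, Y s \<omega>, Y (s + \<epsilon>) \<omega>)) \<in> borel_measurable (M \<Otimes>\<^sub>M lborel)"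
    by (simp add: case_prod_beta)
  have "(\<lambda>\<omega>. LBINT s. indicator {0..t} s *\<^sub>R ?g (s, Y s \<omega>, Y (s + \<epsilon>) \<omega>)) \<in> borel_measurable M"
    by (rule lborel.borel_measurable_lebesgue_integral) measurable
  moreover have "AE \<omega> in M. (LBINT s. indicator {0..t} s *\<^sub>R ?g (s, Y s \<omega>, Y (s + \<epsilon>) \<omega>)) =
      (LBINT s:{0..t}. D s (X s \<omega>) (a *\<^sub>R (extend_process T X (s + \<epsilon>) \<omega> - extend_process T X s \<omega>)))"
    using \<Omega>\<^sub>0(2)
  proof eventually_elim
    case (elim \<omega>)
    show ?case unfolding set_lebesgue_integral_def
    proof (rule Bochner_Integration.integral_cong[OF refl])
      fix s
      show "indicat_real {0..t} s *\<^sub>R ?g (s, Y s \<omega>, Y (s + \<epsilon>) \<omega>) = indicat_real {0..t} s *\<^sub>R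
        D s (X s \<omega>) (a *\<^sub>R (extend_process T X (s + \<epsilon>) \<omega> - extend_process T X s \<omega>))"
      proof (cases "s \<in> {0..t}")
        case True
        then have "clip T s = s" using t by auto
        then show ?thesis using XY[OF elim] by (simp add: extend_process_def)
      qed simp
    qed
  qed
  ultimately show ?thesis by (rule complete_measure.borel_measurable_AE_cong[OF M])
qed

section \<open>The Ito formula\<close>

text \<open>Here the step functions \<open>ps\<close> are given in advance and the subsequence \<open>r\<close> depends on \<open>\<epsilon>\<close>. It is obtained
  from (H1) first and then, by (H2), refined so that the approximations of the quadratic variation
  converge for all pairs from the countable set \<open>C \<times> grid t\<close>, on which \<open>V\<close> and \<open>Q\<close> agree almost surely.
  As the first limit does not involve \<open>r\<close>, neither does \<open>S\<close>.\<close>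

lemma ito_along_subsequence:
  fixes X :: "real \<Rightarrow> 'w \<Rightarrow> 'b::{banach, second_countable_topology}"
    and \<iota> :: "'c::banach \<Rightarrow>\<^sub>L 'b \<Rightarrow>\<^sub>L 'b \<Rightarrow>\<^sub>L real"
    and V :: "real \<Rightarrow> 'w \<Rightarrow> 'c \<Rightarrow>\<^sub>L real" and \<epsilon> :: "nat \<Rightarrow> real"
  assumes prob: "prob_space M" and complete: "complete_measure M" and T: "0 < T" and t: "t \<in> {0..T}"
    and X: "continuous_process M T X"
    and H1: "qv_H1 M T \<iota> X" and H2i: "qv_H2i M T \<iota> X Q" and H2ii: "qv_H2ii M T Q V"
    and C12: "frechet_C12 T F F\<^sub>t DF D2F"
    and G: "\<And>t \<eta>. t \<in> {0..T} \<Longrightarrow> \<iota> (G t \<eta>) = D2F t \<eta>"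
      "continuous_on ({0..T} \<times> UNIV) (\<lambda>(t, \<eta>). G t \<eta>)"
    and C: "countable C"
    and ps: "AE \<omega> in M. \<forall>n.
        (\<forall>(c, d, \<phi>)\<in>set (ps \<omega> n). 0 \<le> c \<and> c \<le> d \<and> d \<le> t \<and> c \<in> grid t \<and> d \<in> grid t \<and> \<phi> \<in> C) \<and>
        (\<forall>s\<in>{0<..t}. norm (step_fun (ps \<omega> n) s - G s (X s \<omega>)) \<le> 1 / real (Suc n))"
    and \<epsilon>: "\<And>n. 0 < \<epsilon> n" "decseq \<epsilon>" "\<epsilon> \<longlonglongrightarrow> 0"
  shows "\<exists>r::nat \<Rightarrow> nat. strict_mono r \<and> (AE \<omega> in M. \<exists>S.
      (\<lambda>n. step_integral (\<lambda>s. V s \<omega>) (ps \<omega> n)) \<longlonglongrightarrow> S \<and>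
      (\<lambda>k. LBINT s:{0..t}. DF s (X s \<omega>) (inverse (\<epsilon> (r k)) *\<^sub>R
          (extend_process T X (s + \<epsilon> (r k)) \<omega> - extend_process T X s \<omega>))) \<longlonglongrightarrow>
        F t (X t \<omega>) - F 0 (X 0 \<omega>) - (LBINT s:{0..t}. F\<^sub>t s (X s \<omega>)) - 1 / 2 * S)"
proof -
  interpret prob_space M by fact
  obtain r1 :: "nat \<Rightarrow> nat" where r1: "strict_mono r1"
    and sup: "AE \<omega> in M. (SUP k. \<integral>\<^sup>+s\<in>{0..T}.
              ennreal (inverse (\<epsilon> (r1 k)) * norm (increment_square T \<iota> X (\<epsilon> (r1 k)) s \<omega>)) \<partial>lborel) < \<infinity>"
    using H1 \<epsilon> unfolding qv_H1_def by blast
  let ?J = "C \<times> (grid t \<inter> {0..T})"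
  have fl: "filterlim (\<lambda>n. \<epsilon> (r1 n)) (at_right 0) sequentially"
    using \<epsilon>(1) LIMSEQ_subseq_LIMSEQ[OF \<epsilon>(3) r1]
    by (auto simp: filterlim_at o_def intro!: always_eventually) (metis less_irrefl)
  have cp: "converges_in_probability M (\<lambda>\<epsilon>. qv_approx T \<iota> X \<phi> \<epsilon> \<tau>) (Q \<phi> \<tau>) (at_right 0)"
    if "\<tau> \<in> {0..T}" for \<phi> \<tau>
    using H2i by (intro converges_ucp_imp_pointwise[OF complete _ that]) (auto simp: qv_H2i_def)
  have "\<exists>r2::nat \<Rightarrow> nat. strict_mono r2 \<and> (AE \<omega> in M. \<forall>j\<in>?J.
      (\<lambda>k. qv_approx T \<iota> X (fst j) (\<epsilon> (r1 (r2 k))) (snd j) \<omega> - Q (fst j) (snd j) \<omega>) \<longlonglongrightarrow> 0)"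
  proof (rule common_AE_subsequence[of ?J "\<lambda>j n \<omega>. qv_approx T \<iota> X (fst j) (\<epsilon> (r1 n)) (snd j) \<omega> - Q (fst j) (snd j) \<omega>"])
    show "countable ?J" using C countable_grid by auto
    fix j assume "j \<in> ?J"
    then have *: "snd j \<in> {0..T}" by auto
    have Q: "Q (fst j) (snd j) \<in> borel_measurable M"
      and Z: "\<forall>\<^sub>F \<epsilon> in at_right 0. qv_approx T \<iota> X (fst j) \<epsilon> (snd j) \<in> borel_measurable M"
      using cp[OF *, of "fst j"] by (auto simp: converges_in_probability_def)
    from eventually_compose_filterlim[OF Z fl]
    show "\<forall>\<^sub>F n in sequentially. (\<lambda>\<omega>. qv_approx T \<iota> X (fst j) (\<epsilon> (r1 n)) (snd j) \<omega> - Q (fst j) (snd j) \<omega>) \<in> borel_measurable M"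
      by eventually_elim (use Q in simp)
    fix \<delta> :: real assume "0 < \<delta>"
    then have "((\<lambda>\<epsilon>. measure M {\<omega>\<in>space M. \<delta> < \<bar>qv_approx T \<iota> X (fst j) \<epsilon> (snd j) \<omega> - Q (fst j) (snd j) \<omega>\<bar>})
        \<longlongrightarrow> 0) (at_right 0)"
      using cp[OF *, of "fst j"] by (auto simp: converges_in_probability_def)
    from filterlim_compose[OF this fl]
    show "(\<lambda>n. measure M {\<omega>\<in>space M. \<delta> < \<bar>qv_approx T \<iota> X (fst j) (\<epsilon> (r1 n)) (snd j) \<omega> - Q (fst j) (snd j) \<omega>\<bar>}) \<longlonglongrightarrow> 0" .
  qed
  then obtain r2 :: "nat \<Rightarrow> nat" where r2: "strict_mono r2"
    and conv: "AE \<omega> in M. \<forall>j\<in>?J.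
      (\<lambda>k. qv_approx T \<iota> X (fst j) (\<epsilon> (r1 (r2 k))) (snd j) \<omega> - Q (fst j) (snd j) \<omega>) \<longlonglongrightarrow> 0"
    by blast
  define r where "r = r1 \<circ> r2"
  have r: "strict_mono r" unfolding r_def using r1 r2 by (rule strict_mono_o)
  have \<epsilon>r: "\<And>k. 0 < \<epsilon> (r k)" "(\<lambda>k. \<epsilon> (r k)) \<longlonglongrightarrow> 0"
    using \<epsilon>(1) LIMSEQ_subseq_LIMSEQ[OF \<epsilon>(3) r] by (auto simp: o_def)
  have VQ: "AE \<omega> in M. \<forall>j\<in>?J. V (snd j) \<omega> (fst j) = Q (fst j) (snd j) \<omega>"
  proof (rule AE_ball_countable')
    show "countable ?J" using C countable_grid by auto
    show "AE \<omega> in M. V (snd j) \<omega> (fst j) = Q (fst j) (snd j) \<omega>" if "j \<in> ?J" for j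
      using H2ii that unfolding qv_H2ii_def by fastforce
  qed
  have cont: "AE \<omega> in M. continuous_on {0..T} (\<lambda>s. X s \<omega>)" using X by (simp add: continuous_process_def)
  from sup conv VQ cont ps
  have "AE \<omega> in M. \<exists>S.
      (\<lambda>n. step_integral (\<lambda>s. V s \<omega>) (ps \<omega> n)) \<longlonglongrightarrow> S \<and>
      (\<lambda>k. LBINT s:{0..t}. DF s (X s \<omega>) (inverse (\<epsilon> (r k)) *\<^sub>R
          (extend_process T X (s + \<epsilon> (r k)) \<omega> - extend_process T X s \<omega>))) \<longlonglongrightarrow>
        F t (X t \<omega>) - F 0 (X 0 \<omega>) - (LBINT s:{0..t}. F\<^sub>t s (X s \<omega>)) - 1 / 2 * S"
  proof eventually_elim
    case (elim \<omega>)
    note x = elim(4)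
    define \<Delta> where "\<Delta> k s = X (clip T (s + \<epsilon> (r k))) \<omega> - X (clip T s) \<omega>" for k s
    define m where "m k s = inverse (\<epsilon> (r k)) *\<^sub>R chi_tensor \<iota> (\<Delta> k s) (\<Delta> k s)" for k s
    define K where "K = enn2real (SUP k. \<integral>\<^sup>+s\<in>{0..T}.
              ennreal (inverse (\<epsilon> (r1 k)) * norm (increment_square T \<iota> X (\<epsilon> (r1 k)) s \<omega>)) \<partial>lborel)"
    have inc: "increment_square T \<iota> X (\<epsilon> (r k)) s \<omega> = chi_tensor \<iota> (\<Delta> k s) (\<Delta> k s)" for k s
      by (simp add: increment_square_def extend_process_def \<Delta>_def Let_def)
    have K: "(\<integral>\<^sup>+s\<in>{0..t}. ennreal (norm (m k s)) \<partial>lborel) \<le> ennreal K" for k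
    proof -
      have "(\<integral>\<^sup>+s\<in>{0..t}. ennreal (norm (m k s)) \<partial>lborel) \<le> (\<integral>\<^sup>+s\<in>{0..T}.
              ennreal (inverse (\<epsilon> (r k)) * norm (increment_square T \<iota> X (\<epsilon> (r k)) s \<omega>)) \<partial>lborel)"
        using \<epsilon>r(1)[of k] t by (intro nn_integral_mono) (auto simp: m_def inc indicator_def)
      also have "\<dots> \<le> (SUP k. \<integral>\<^sup>+s\<in>{0..T}.
              ennreal (inverse (\<epsilon> (r1 k)) * norm (increment_square T \<iota> X (\<epsilon> (r1 k)) s \<omega>)) \<partial>lborel)"
        by (rule SUP_upper2[of "r2 k"]) (auto simp: r_def)
      also have "\<dots> = ennreal K" unfolding K_def using elim(1) by (simp add: ennreal_enn2real)
      finally show ?thesis .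
    qed
    have K0: "0 \<le> K" by (simp add: K_def)
    have cx: "continuous_on {0..t} (\<lambda>s. X s \<omega>)" by (rule continuous_on_subset[OF x]) (use t in auto)
    have y: "continuous_on {0..t} (\<lambda>s. X (clip T (s + c)) \<omega>)" for c
      by (rule continuous_on_compose2[OF x]) (use T in \<open>auto intro!: continuous_intros\<close>)
    have cm: "continuous_on {0..t} (m k)" for k
      unfolding m_def \<Delta>_def using y[of 0] by (intro continuous_intros continuous_on_chi_tensor y) auto
    have cG: "continuous_on {0..t} (\<lambda>s. G s (X s \<omega>))"
      using t by (intro continuous_on_time_space[OF G(2)] continuous_intros cx) auto
    have qv: "(\<lambda>k. LBINT s:{0..\<tau>}. m k s \<phi>) \<longlonglongrightarrow> V \<tau> \<omega> \<phi>"
      if "\<phi> \<in> C" "\<tau> \<in> grid t" "0 \<le> \<tau>" "\<tau> \<le> t" for \<phi> \<tau>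
    proof -
      have j: "(\<phi>, \<tau>) \<in> ?J" using that t by auto
      have "(\<lambda>k. qv_approx T \<iota> X \<phi> (\<epsilon> (r k)) \<tau> \<omega>) \<longlonglongrightarrow> Q \<phi> \<tau> \<omega>"
        using bspec[OF elim(2) j] by (simp add: r_def LIM_zero_iff)
      moreover have "V \<tau> \<omega> \<phi> = Q \<phi> \<tau> \<omega>" using bspec[OF elim(3) j] by simp
      ultimately show ?thesis by (simp add: qv_approx_def inc m_def)
    qed
    have "\<exists>S. (\<lambda>n. step_integral (\<lambda>s. V s \<omega>) (ps \<omega> n)) \<longlonglongrightarrow> S \<and>
        (\<lambda>k. LBINT s:{0..t}. m k s (G s (X s \<omega>))) \<longlonglongrightarrow> S"
    proof (rule stieltjes_sums_limit[OF cm K K0 cG])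
      show "\<forall>(c, d, \<phi>)\<in>set (ps \<omega> n). 0 \<le> c \<and> c \<le> d \<and> d \<le> t" for n
        using conjunct1[OF spec[OF elim(5), of n]] by auto
      show "norm (step_fun (ps \<omega> n) s - G s (X s \<omega>)) \<le> 1 / real (Suc n)" if "s \<in> {0<..t}" for n s
        using elim(5) that by blast
      show "(\<lambda>n. 1 / real (Suc n)) \<longlonglongrightarrow> 0" using LIMSEQ_inverse_real_of_nat by (simp add: inverse_eq_divide)
      fix n c d \<phi> assume "(c, d, \<phi>) \<in> set (ps \<omega> n)"
      then have "0 \<le> c \<and> c \<le> d \<and> d \<le> t \<and> c \<in> grid t \<and> d \<in> grid t \<and> \<phi> \<in> C"
        using conjunct1[OF spec[OF elim(5), of n]] by auto
      then show "(\<lambda>k. LBINT s:{0..c}. m k s \<phi>) \<longlonglongrightarrow> V c \<omega> \<phi> \<and> (\<lambda>k. LBINT s:{0..d}. m k s \<phi>) \<longlonglongrightarrow> V d \<omega> \<phi>"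
        by (intro conjI qv) auto
    qed simp
    then obtain S where S: "(\<lambda>n. step_integral (\<lambda>s. V s \<omega>) (ps \<omega> n)) \<longlonglongrightarrow> S"
      "(\<lambda>k. LBINT s:{0..t}. m k s (G s (X s \<omega>))) \<longlonglongrightarrow> S" by blast
    have "(\<lambda>k. LBINT s:{0..t}. DF s (X s \<omega>) (inverse (\<epsilon> (r k)) *\<^sub>R \<Delta> k s)) \<longlonglongrightarrow>
        F t (X t \<omega>) - F 0 (X 0 \<omega>) - (LBINT s:{0..t}. F\<^sub>t s (X s \<omega>)) - 1 / 2 * S"
      using K S(2) unfolding m_def \<Delta>_def
      by (intro pathwise_ito[where x="\<lambda>s. X s \<omega>", OF T t x C12 G \<epsilon>r _ K0]) auto
    with S(1) show ?case by (auto simp: \<Delta>_def extend_process_def)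
  qed
  with r show ?thesis by blast
qed

theorem theorem5p2:
  fixes M :: "'w measure" and \<F> :: "real \<Rightarrow> 'w measure" and T :: real
    and \<iota> :: "'c::banach \<Rightarrow>\<^sub>L 'b::{banach, second_countable_topology} \<Rightarrow>\<^sub>L 'b \<Rightarrow>\<^sub>L real"
    and X :: "real \<Rightarrow> 'w \<Rightarrow> 'b"
    and V :: "real \<Rightarrow> 'w \<Rightarrow> 'c \<Rightarrow>\<^sub>L real"
    and F F\<^sub>t :: "real \<Rightarrow> 'b \<Rightarrow> real"
    and DF :: "real \<Rightarrow> 'b \<Rightarrow> 'b \<Rightarrow>\<^sub>L real"
    and D2F :: "real \<Rightarrow> 'b \<Rightarrow> 'b \<Rightarrow>\<^sub>L 'b \<Rightarrow>\<^sub>L real"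
    and D2F\<^sub>\<chi> :: "real \<Rightarrow> 'b \<Rightarrow> 'c"
  assumes "0 < T"
    and "prob_space M"
    and "usual_conditions M T \<F>"
    and "chi_subspace \<iota>"
    and "continuous_process M T X"
    and "chi_quadratic_variation M T \<iota> X V"
    and "frechet_C12 T F F\<^sub>t DF D2F"
    and "\<And>t \<eta>. t \<in> {0..T} \<Longrightarrow> \<iota> (D2F\<^sub>\<chi> t \<eta>) = D2F t \<eta>"
    and "continuous_on ({0..T} \<times> UNIV) (\<lambda>(t, \<eta>). D2F\<^sub>\<chi> t \<eta>)"
  shows "\<forall>t\<in>{0..T}. \<exists>I. has_forward_integral M T (\<lambda>s \<omega>. DF s (X s \<omega>)) X t I \<and>
    (AE \<omega> in M. \<exists>S. has_stieltjes_integral 0 t (\<lambda>s. D2F\<^sub>\<chi> s (X s \<omega>)) (\<lambda>s. V s \<omega>) S \<and>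
       F t (X t \<omega>) = F 0 (X 0 \<omega>) + (LBINT s:{0..t}. F\<^sub>t s (X s \<omega>)) + I \<omega> + 1 / 2 * S)"
proof
  fix t assume t: "t \<in> {0..T}"
  note T = assms(1) and prob = assms(2) and X = assms(5) and C12 = assms(7) and G = assms(8,9)
  interpret prob_space M by (rule prob)
  have complete: "complete_measure M" using complete_measure_of_usual_conditions[OF assms(3)] T by simp
  obtain Q where H: "qv_H1 M T \<iota> X" "qv_H2i M T \<iota> X Q" "qv_H2ii M T Q V"
    using assms(6) unfolding chi_quadratic_variation_def by blast
  note D = frechet_C12_D[OF C12]
  have cont: "AE \<omega> in M. continuous_on {0..T} (\<lambda>s. X s \<omega>)" using X by (simp add: continuous_process_def)
  obtain C where C: "countable C"
    "\<And>s \<eta> d. s \<in> {0..T} \<Longrightarrow> 0 < d \<Longrightarrow> \<exists>\<phi>\<in>C. norm (\<phi> - D2F\<^sub>\<chi> s \<eta>) < d"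
    using countable_dense_in_range[OF G(2)] by blast
  define good where "good \<omega> n qs \<longleftrightarrow>
      (\<forall>(c, d, \<phi>)\<in>set qs. 0 \<le> c \<and> c \<le> d \<and> d \<le> t \<and> c \<in> grid t \<and> d \<in> grid t \<and> \<phi> \<in> C) \<and>
      (\<forall>s\<in>{0<..t}. norm (step_fun qs s - D2F\<^sub>\<chi> s (X s \<omega>)) \<le> 1 / real (Suc n))" for \<omega> n qs
  define ps where "ps \<omega> n = (SOME qs. good \<omega> n qs)" for \<omega> n
  have "AE \<omega> in M. \<forall>n. good \<omega> n (ps \<omega> n)"
    using cont
  proof eventually_elim
    case (elim \<omega>)
    have cG: "continuous_on {0..t} (\<lambda>s. D2F\<^sub>\<chi> s (X s \<omega>))"
      using t by (intro continuous_on_time_space[OF G(2)] continuous_intros continuous_on_subset[OF elim]) auto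
    have "\<exists>qs. good \<omega> n qs" for n
      unfolding good_def by (rule step_approximation[OF _ cG]) (use t C(2) in auto)
    then show ?case unfolding ps_def by (blast intro: someI_ex)
  qed
  then have ps: "AE \<omega> in M. \<forall>n.
      (\<forall>(c, d, \<phi>)\<in>set (ps \<omega> n). 0 \<le> c \<and> c \<le> d \<and> d \<le> t \<and> c \<in> grid t \<and> d \<in> grid t \<and> \<phi> \<in> C) \<and>
      (\<forall>s\<in>{0<..t}. norm (step_fun (ps \<omega> n) s - D2F\<^sub>\<chi> s (X s \<omega>)) \<le> 1 / real (Suc n))"
    unfolding good_def .
  define Z where "Z \<epsilon> \<omega> = (LBINT s:{0..t}. DF s (X s \<omega>) (inverse \<epsilon> *\<^sub>R
      (extend_process T X (s + \<epsilon>) \<omega> - extend_process T X s \<omega>)))" for \<epsilon> \<omega>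
  \<comment> \<open>\<open>S\<close> and \<open>I\<close> are functions of \<open>\<omega>\<close> alone and do not depend on a sequence \<open>\<epsilon>\<close>.\<close>
  define S where "S \<omega> = lim (\<lambda>n. step_integral (\<lambda>s. V s \<omega>) (ps \<omega> n))" for \<omega>
  define I where "I \<omega> = F t (X t \<omega>) - F 0 (X 0 \<omega>) - (LBINT s:{0..t}. F\<^sub>t s (X s \<omega>)) - 1 / 2 * S \<omega>" for \<omega>
  have sub: "\<exists>r::nat \<Rightarrow> nat. strict_mono r \<and> (AE \<omega> in M.
      (\<lambda>n. step_integral (\<lambda>s. V s \<omega>) (ps \<omega> n)) \<longlonglongrightarrow> S \<omega> \<and> (\<lambda>k. Z (\<epsilon> (r k)) \<omega>) \<longlonglongrightarrow> I \<omega>)"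
    if \<epsilon>: "\<And>n. 0 < \<epsilon> n" "decseq \<epsilon>" "\<epsilon> \<longlonglongrightarrow> 0" for \<epsilon> :: "nat \<Rightarrow> real"
  proof -
    obtain r :: "nat \<Rightarrow> nat" where r: "strict_mono r" "AE \<omega> in M. \<exists>S'.
      (\<lambda>n. step_integral (\<lambda>s. V s \<omega>) (ps \<omega> n)) \<longlonglongrightarrow> S' \<and> (\<lambda>k. Z (\<epsilon> (r k)) \<omega>) \<longlonglongrightarrow>
        F t (X t \<omega>) - F 0 (X 0 \<omega>) - (LBINT s:{0..t}. F\<^sub>t s (X s \<omega>)) - 1 / 2 * S'"
      using ito_along_subsequence[OF prob complete T t X H C12 G C(1) ps \<epsilon>] unfolding Z_def by blast
    from r(2) have "AE \<omega> in M. (\<lambda>n. step_integral (\<lambda>s. V s \<omega>) (ps \<omega> n)) \<longlonglongrightarrow> S \<omega> \<and> (\<lambda>k. Z (\<epsilon> (r k)) \<omega>) \<longlonglongrightarrow> I \<omega>"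
      by eventually_elim (auto simp: I_def S_def dest: limI)
    with r(1) show ?thesis by blast
  qed
  have Zm: "Z \<epsilon> \<in> borel_measurable M" for \<epsilon>
    unfolding Z_def using T by (intro forward_quotient_measurable[OF complete _ t X D(6)]) simp
  \<comment> \<open>One particular sequence yields the measurability of \<open>I\<close> and the convergence of the Stieltjes sums.\<close>
  obtain r :: "nat \<Rightarrow> nat" where
    lim: "AE \<omega> in M. (\<lambda>n. step_integral (\<lambda>s. V s \<omega>) (ps \<omega> n)) \<longlonglongrightarrow> S \<omega> \<and>
      (\<lambda>k. Z (inverse (real (Suc (r k)))) \<omega>) \<longlonglongrightarrow> I \<omega>"
    using sub[of "\<lambda>n. inverse (real (Suc n))"] LIMSEQ_inverse_real_of_nat
    by (auto simp: decseq_def)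
  have Im: "I \<in> borel_measurable M"
  proof (rule complete_measure.borel_measurable_AE_cong[OF complete])
    show "(\<lambda>\<omega>. lim (\<lambda>k. Z (inverse (real (Suc (r k)))) \<omega>)) \<in> borel_measurable M"
      using Zm by (intro borel_measurable_lim_metric)
    show "AE \<omega> in M. lim (\<lambda>k. Z (inverse (real (Suc (r k)))) \<omega>) = I \<omega>"
      using lim by eventually_elim (auto dest: limI)
  qed
  have "has_forward_integral M T (\<lambda>s \<omega>. DF s (X s \<omega>)) X t I"
    unfolding has_forward_integral_def
  proof (intro conjI X)
    show "strongly_measurable_process M T (\<lambda>s \<omega>. DF s (X s \<omega>))"
      using T by (intro strongly_measurable_along_process[OF _ X D(6)]) simp
    show "AE \<omega> in M. (\<integral>\<^sup>+s\<in>{0..T}. ennreal (norm (DF s (X s \<omega>))) \<partial>lborel) < \<infinity>"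
      using cont
    proof eventually_elim
      case (elim \<omega>)
      have "continuous_on {0..T} (\<lambda>s. norm (DF s (X s \<omega>)))"
        by (intro continuous_on_time_space[OF D(6)] continuous_intros elim) auto
      from borel_integrable_atLeastAtMost'[OF this]
      have "integrable lborel (\<lambda>s. indicator {0..T} s *\<^sub>R norm (DF s (X s \<omega>)))" by (simp add: set_integrable_def)
      then have "(\<integral>\<^sup>+s. ennreal (norm (indicator {0..T} s *\<^sub>R norm (DF s (X s \<omega>)))) \<partial>lborel) < \<infinity>"
        by (simp add: integrable_iff_bounded)
      also have "(\<integral>\<^sup>+s. ennreal (norm (indicator {0..T} s *\<^sub>R norm (DF s (X s \<omega>)))) \<partial>lborel) =
          (\<integral>\<^sup>+s\<in>{0..T}. ennreal (norm (DF s (X s \<omega>))) \<partial>lborel)"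
        by (intro nn_integral_cong) (simp add: indicator_def)
      finally show ?case .
    qed
    show "converges_in_probability M
       (\<lambda>\<epsilon> \<omega>. LBINT s:{0..t}. DF s (X s \<omega>) (inverse \<epsilon> *\<^sub>R (extend_process T X (s + \<epsilon>) \<omega> - extend_process T X s \<omega>)))
       I (at_right 0)"
      unfolding Z_def[symmetric]
    proof (rule converges_in_probability_at_right_0I[OF Zm Im])
      fix \<epsilon> :: "nat \<Rightarrow> real" assume "\<And>n. 0 < \<epsilon> n" "decseq \<epsilon>" "\<epsilon> \<longlonglongrightarrow> 0"
      from sub[OF this] show "\<exists>r. strict_mono r \<and> (AE \<omega> in M. (\<lambda>k. Z (\<epsilon> (r k)) \<omega>) \<longlonglongrightarrow> I \<omega>)" by auto
    qed
  qed
  moreover have "AE \<omega> in M. \<exists>S. has_stieltjes_integral 0 t (\<lambda>s. D2F\<^sub>\<chi> s (X s \<omega>)) (\<lambda>s. V s \<omega>) S \<and>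
       F t (X t \<omega>) = F 0 (X 0 \<omega>) + (LBINT s:{0..t}. F\<^sub>t s (X s \<omega>)) + I \<omega> + 1 / 2 * S"
    using ps lim
  proof eventually_elim
    case (elim \<omega>)
    show ?case
    proof (intro exI[of _ "S \<omega>"] conjI)
      show "has_stieltjes_integral 0 t (\<lambda>s. D2F\<^sub>\<chi> s (X s \<omega>)) (\<lambda>s. V s \<omega>) (S \<omega>)"
      proof (rule has_stieltjes_integral_uniform_limit)
        show "\<forall>(c, d, \<phi>)\<in>set (ps \<omega> n). 0 \<le> c \<and> c \<le> d \<and> d \<le> t" for n
          using conjunct1[OF spec[OF elim(1), of n]] by auto
        show "norm (step_fun (ps \<omega> n) s - D2F\<^sub>\<chi> s (X s \<omega>)) \<le> 1 / real (Suc n)" if "s \<in> {0<..t}" for n s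
          using elim(1) that by blast
        show "(\<lambda>n. 1 / real (Suc n)) \<longlonglongrightarrow> 0" using LIMSEQ_inverse_real_of_nat by (simp add: inverse_eq_divide)
      qed (use t elim(2) in auto)
    qed (simp add: I_def)
  qed
  ultimately show "\<exists>I. has_forward_integral M T (\<lambda>s \<omega>. DF s (X s \<omega>)) X t I \<and>
    (AE \<omega> in M. \<exists>S. has_stieltjes_integral 0 t (\<lambda>s. D2F\<^sub>\<chi> s (X s \<omega>)) (\<lambda>s. V s \<omega>) S \<and>
       F t (X t \<omega>) = F 0 (X 0 \<omega>) + (LBINT s:{0..t}. F\<^sub>t s (X s \<omega>)) + I \<omega> + 1 / 2 * S)"
    by blast
qed

end
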